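(* Let $\mathbf{k}$ be a commutative $\mathbb{Q}$-algebra and $\lambda\in\mathbf{k}$. Then the free commutative integro-differential algebra $\mathrm{ID}(\mathbf{k}\{u\})$ of weight $\lambda$ on the differential algebra $\mathbf{k}\{u\}$ of differential polynomials in one variable (with its canonical derivation of weight $\lambda$) is a polynomial algebra, i.e. it is isomorphic as a $\mathbf{k}$-algebra to a polynomial algebra over $\mathbf{k}$ on some set of variables.
   Context: A differential $\mathbf{k}$-algebra of weight $\lambda$ is a unitary associative $\mathbf{k}$-algebra $R$ with a $\mathbf{k}$-linear $d\colon R\to R$ such that $d(xy)=d(x)y+xd(y)+\lambda d(x)d(y)$ for all $x,y$ and $d(1)=0$. An integro-differential $\mathbf{k}$-algebra of weight $\lambda$ is a differential $\mathbf{k}$-algebra $(R,D)$ of weight $\lambda$ with a $\mathbf{k}$-linear $\Pi\colon R\to R$ such that $D\circ\Pi=\mathrm{id}_R$ and $\Pi(D(x))\Pi(D(y))=\Pi(D(x))y+x\Pi(D(y))-\Pi(D(xy))$ for all $x,y\in R$. Homomorphisms are unital $\mathbf{k}$-algebra homomorphisms commuting with the operators. The algebra $\mathbf{k}\{u\}$ is $\mathbf{k}[u_i\mid i\ge0]$ with the derivation of weight $\lambda$ determined by $d(u_i)=u_{i+1}$. For a commutative differential algebra $(A,d)$ of weight $\lambda$, the free commutative integro-differential algebra $\mathrm{ID}(A)$ of weight $\lambda$ on $A$ is a commutative integro-differential algebra of weight $\lambda$ together with a differential algebra homomorphism $i_A\colon A\to\mathrm{ID}(A)$ such that for every commutative integro-differential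 algebra $R$ of weight $\lambda$ and every differential algebra homomorphism $f\colon A\to R$ there is a unique integro-differential algebra homomorphism $\bar f\colon\mathrm{ID}(A)\to R$ with $\bar f\circ i_A=f$. (It exists and is unique up to isomorphism.) *)

theory Defs
  imports "HOL-Algebra.Algebra" "HOL-Algebra.Algebraic_Closure_Type"
begin

section \<open>Polynomial algebras\<close>

text \<open>
  The polynomial algebra \<open>k[x | x \<in> V]\<close>, built on the indexed polynomials of the library: a
  polynomial is its coefficient function on monomials, and a monomial is a multiset of variables.
  The library has no product of two indexed polynomials; it is the convolution below, where the sum
  ranges over the (finitely many) submultisets of \<open>m\<close>.
\<close>

definition mpoly :: "('k, 'm) ring_scheme \<Rightarrow> 'x set \<Rightarrow> ('k, 'x multiset \<Rightarrow> 'k) module" where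
  "mpoly k V =
    \<lparr> carrier = ring.indexed_pset k V (carrier k),
      monoid.mult = (\<lambda>p q m. \<Oplus>\<^bsub>k\<^esub>n\<in>{n. n \<subseteq># m}. p n \<otimes>\<^bsub>k\<^esub> q (m - n)),
      monoid.one = ring.indexed_const k \<one>\<^bsub>k\<^esub>,
      ring.zero = ring.indexed_const k \<zero>\<^bsub>k\<^esub>,
      add = ring.indexed_padd k,
      module.smult = (\<lambda>c p m. c \<otimes>\<^bsub>k\<^esub> p m) \<rparr>"

lemma finite_submultisets: "finite {n. n \<subseteq># m}"
proof (induction m)
  case empty
  then show ?case by simp
next
  case (add x m)
  have "{n. n \<subseteq># add_mset x m} \<subseteq> {n. n \<subseteq># m} \<union> add_mset x ` {n. n \<subseteq># m}"
  proof
    fix n assume "n \<in> {n. n \<subseteq># add_mset x m}"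
    then have n: "n \<subseteq># add_mset x m" by simp
    show "n \<in> {n. n \<subseteq># m} \<union> add_mset x ` {n. n \<subseteq># m}"
    proof (cases "x \<in># n")
      case True
      then obtain n' where "n = add_mset x n'" by (metis insert_DiffM)
      with n show ?thesis by simp
    next
      case False
      with n have "n \<subseteq># m"
        by (metis count_add_mset count_eq_zero_iff le0 subseteq_mset_def)
      then show ?thesis by simp
    qed
  qed
  with add show ?case by (meson finite_UnI finite_imageI finite_subset)
qed

context cring
begin

lemma mpoly_carrierD:
  assumes "p \<in> carrier (mpoly R V)"
  shows "p m \<in> carrier R" and "finite {m. p m \<noteq> \<zero>}" and "p m \<noteq> \<zero> \<Longrightarrow> set_mset m \<subseteq> V"
proof -
  have "p \<in> indexed_pset V (carrier R)" using assms by (simp add: mpoly_def)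
  then have "(\<forall>m. p m \<in> carrier R) \<and> finite {m. p m \<noteq> \<zero>} \<and> (\<forall>m. p m \<noteq> \<zero> \<longrightarrow> set_mset m \<subseteq> V)"
  proof induction
    case (indexed_const k)
    have "finite {m. ring.indexed_const R k m \<noteq> \<zero>}"
      by (rule finite_subset[of _ "{{#}}"]) (auto simp: indexed_const_def)
    then show ?case using indexed_const by (auto simp: indexed_const_def)
  next
    case (indexed_padd P Q)
    have "{m. (P \<Oplus> Q) m \<noteq> \<zero>} \<subseteq> {m. P m \<noteq> \<zero>} \<union> {m. Q m \<noteq> \<zero>}"
      by (auto simp: indexed_padd_def)
    moreover have "finite ({m. P m \<noteq> \<zero>} \<union> {m. Q m \<noteq> \<zero>})"
      using indexed_padd by blast
    ultimately have "finite {m. (P \<Oplus> Q) m \<noteq> \<zero>}" by (rule finite_subset)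
    moreover have "P m \<noteq> \<zero> \<or> Q m \<noteq> \<zero>" if "(P \<Oplus> Q) m \<noteq> \<zero>" for m
      using that by (auto simp: indexed_padd_def)
    then have "\<forall>m. (P \<Oplus> Q) m \<noteq> \<zero> \<longrightarrow> set_mset m \<subseteq> V"
      using indexed_padd by blast
    moreover have "\<forall>m. (P \<Oplus> Q) m \<in> carrier R"
      using indexed_padd by (simp add: indexed_padd_def)
    ultimately show ?case by blast
  next
    case (indexed_pmult P i)
    have "finite {m. (P \<Otimes> i) m \<noteq> \<zero>}"
    proof (rule finite_subset)
      show "{m. (P \<Otimes> i) m \<noteq> \<zero>} \<subseteq> add_mset i ` {m. P m \<noteq> \<zero>}"
        by (auto simp: indexed_pmult_def image_iff split: if_splits) (metis insert_DiffM)
    qed (use indexed_pmult in simp)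
    moreover have "set_mset m \<subseteq> V" if "(P \<Otimes> i) m \<noteq> \<zero>" for m
    proof -
      from that have i: "i \<in># m" and "P (m - {#i#}) \<noteq> \<zero>"
        by (auto simp: indexed_pmult_def split: if_splits)
      with indexed_pmult have "set_mset (m - {#i#}) \<subseteq> V" by blast
      with indexed_pmult(2) i show ?thesis
        by (metis insert_DiffM insert_subset set_mset_add_mset_insert)
    qed
    ultimately show ?case using indexed_pmult by (auto simp: indexed_pmult_def)
  qed
  then show "p m \<in> carrier R" and "finite {m. p m \<noteq> \<zero>}" and "p m \<noteq> \<zero> \<Longrightarrow> set_mset m \<subseteq> V"
    by auto
qed

lemma mpoly_monom:
  assumes "c \<in> carrier R" "set_mset m \<subseteq> V"
  shows "(\<lambda>n. if n = m then c else \<zero>) \<in> indexed_pset V (carrier R)"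
  using assms(2)
proof (induction m)
  case empty
  then show ?case
    using indexed_pset.indexed_const[OF assms(1), of V] by (simp add: indexed_const_def)
next
  case (add x m)
  then have "(\<lambda>n. if n = m then c else \<zero>) \<Otimes> x \<in> indexed_pset V (carrier R)"
    by (intro indexed_pset.indexed_pmult) auto
  moreover have "(\<lambda>n. if n = m then c else \<zero>) \<Otimes> x = (\<lambda>n. if n = add_mset x m then c else \<zero>)"
    by (auto simp: indexed_pmult_def fun_eq_iff)
  ultimately show ?case by simp
qed

lemma mpoly_carrierI:
  assumes "\<And>m. p m \<in> carrier R" "finite A" "\<And>m. p m \<noteq> \<zero> \<Longrightarrow> m \<in> A \<and> set_mset m \<subseteq> V"
  shows "p \<in> carrier (mpoly R V)"
proof -
  have "p \<in> indexed_pset V (carrier R)"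
    using assms(2,1,3)
  proof (induction A arbitrary: p rule: finite_induct)
    case empty
    then have "p = indexed_const \<zero>" by (auto simp: indexed_const_def)
    then show ?case using indexed_pset.indexed_const[of \<zero> "carrier R" V] by simp
  next
    case (insert a A)
    let ?q = "\<lambda>n. if n = a then \<zero> else p n"
    have q: "?q \<in> indexed_pset V (carrier R)"
      using insert.prems by (intro insert.IH) (auto split: if_splits)
    have "(\<lambda>n. if n = a then p a else \<zero>) \<in> indexed_pset V (carrier R)"
    proof (cases "p a = \<zero>")
      case True
      then have "(\<lambda>n. if n = a then p a else \<zero>) = indexed_const \<zero>" by (auto simp: indexed_const_def)
      then show ?thesis using indexed_pset.indexed_const[of \<zero> "carrier R" V] by simp
    next
      case False
      then show ?thesis using insert.prems by (intro mpoly_monom) auto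
    qed
    from indexed_pset.indexed_padd[OF q this]
    have "?q \<Oplus> (\<lambda>n. if n = a then p a else \<zero>) \<in> indexed_pset V (carrier R)" .
    moreover have "?q \<Oplus> (\<lambda>n. if n = a then p a else \<zero>) = p"
      using insert.prems(1) by (auto simp: indexed_padd_def fun_eq_iff)
    ultimately show ?case by simp
  qed
  then show ?thesis by (simp add: mpoly_def)
qed

lemma finsum_triangle:
  assumes f: "\<And>a b. f a b \<in> carrier R"
  shows "(\<Oplus>n\<in>{n. n \<subseteq># m}. \<Oplus>a\<in>{a. a \<subseteq># n}. f a (n - a)) =
         (\<Oplus>a\<in>{a. a \<subseteq># m}. \<Oplus>b\<in>{b. b \<subseteq># m - a}. f a b)"
proof -
  let ?S = "SIGMA n:{n. n \<subseteq># m}. {a. a \<subseteq># n}"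
  let ?T = "SIGMA a:{a. a \<subseteq># m}. {b. b \<subseteq># m - a}"
  have sig: "(\<Oplus>n\<in>A. \<Oplus>a\<in>B n. g n a) = (\<Oplus>z\<in>Sigma A B. g (fst z) (snd z))"
    if fin: "finite A" "\<And>n. finite (B n)" and g: "\<And>n a. g n a \<in> carrier R"
    for A :: "'d multiset set" and B :: "'d multiset \<Rightarrow> 'd multiset set" and g
    using fin(1)
  proof (induction A rule: finite_induct)
    case empty
    then show ?case by simp
  next
    case (insert x A)
    have "Sigma (insert x A) B = Pair x ` B x \<union> Sigma A B" by auto
    then have "(\<Oplus>z\<in>Sigma (insert x A) B. g (fst z) (snd z)) =
      (\<Oplus>z\<in>Pair x ` B x. g (fst z) (snd z)) \<oplus> (\<Oplus>z\<in>Sigma A B. g (fst z) (snd z))"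
      using insert fin g by (simp only:) (rule finsum_Un_disjoint, auto)
    also have "(\<Oplus>z\<in>Pair x ` B x. g (fst z) (snd z)) = (\<Oplus>a\<in>B x. g x a)"
      using g by (subst finsum_reindex) (auto simp: inj_on_def)
    finally show ?case using insert g by simp
  qed
  have "(\<Oplus>n\<in>{n. n \<subseteq># m}. \<Oplus>a\<in>{a. a \<subseteq># n}. f a (n - a)) = (\<Oplus>z\<in>?S. f (snd z) (fst z - snd z))"
    by (rule sig) (auto simp: finite_submultisets f)
  also have "?S = (\<lambda>z. (fst z + snd z, fst z)) ` ?T"
  proof (intro equalityI subsetI)
    fix z assume "z \<in> ?S"
    then have z: "snd z \<subseteq># fst z" "fst z \<subseteq># m" by auto
    then have "(snd z, fst z - snd z) \<in> ?T" "snd z + (fst z - snd z) = fst z"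
      by (auto simp: subset_eq_diff_conv)
    then show "z \<in> (\<lambda>z. (fst z + snd z, fst z)) ` ?T"
      by (intro image_eqI[of _ _ "(snd z, fst z - snd z)"]) auto
  next
    fix z assume "z \<in> (\<lambda>z. (fst z + snd z, fst z)) ` ?T"
    then show "z \<in> ?S"
      by (auto simp: subset_mset.le_diff_conv2 add.commute)
  qed
  also have "(\<Oplus>z\<in>\<dots>. f (snd z) (fst z - snd z)) = (\<Oplus>z\<in>?T. f (fst z) (snd z))"
    by (subst finsum_reindex) (auto simp: f inj_on_def)
  also have "\<dots> = (\<Oplus>a\<in>{a. a \<subseteq># m}. \<Oplus>b\<in>{b. b \<subseteq># m - a}. f a b)"
    by (rule sig[symmetric]) (auto simp: finite_submultisets f)
  finally show ?thesis .
qed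

lemma algebra_mpoly:
  fixes V :: "'x set"
  shows "algebra R (mpoly R V)"
proof (rule algebraI)
  let ?M = "mpoly R V"
  note D = mpoly_carrierD[of _ V]
  note fs = finite_submultisets
  have mult: "(p \<otimes>\<^bsub>?M\<^esub> q) m = (\<Oplus>n\<in>{n. n \<subseteq># m}. p n \<otimes> q (m - n))" for p q m
    by (simp add: mpoly_def)
  have add: "(p \<oplus>\<^bsub>?M\<^esub> q) m = p m \<oplus> q m" for p q m
    by (simp add: mpoly_def indexed_padd_def)
  have smult: "(c \<odot>\<^bsub>?M\<^esub> q) m = c \<otimes> q m" for c q m
    by (simp add: mpoly_def)
  have one: "\<one>\<^bsub>?M\<^esub> m = (if m = {#} then \<one> else \<zero>)" for m
    by (simp add: mpoly_def indexed_const_def)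
  have zero: "\<zero>\<^bsub>?M\<^esub> m = \<zero>" for m
    by (simp add: mpoly_def indexed_const_def)
  have one_c: "\<one>\<^bsub>?M\<^esub> \<in> carrier ?M"
    by (rule mpoly_carrierI[of _ "{{#}}"]) (auto simp: one split: if_splits)
  have zero_c: "\<zero>\<^bsub>?M\<^esub> \<in> carrier ?M"
    by (rule mpoly_carrierI[of _ "{{#}}"]) (auto simp: zero split: if_splits)
  have add_c: "p \<oplus>\<^bsub>?M\<^esub> q \<in> carrier ?M" if "p \<in> carrier ?M" "q \<in> carrier ?M" for p q
  proof (rule mpoly_carrierI[of _ "{m. p m \<noteq> \<zero>} \<union> {m. q m \<noteq> \<zero>}"])
    show "m \<in> {m. p m \<noteq> \<zero>} \<union> {m. q m \<noteq> \<zero>} \<and> set_mset m \<subseteq> V" if "(p \<oplus>\<^bsub>?M\<^esub> q) m \<noteq> \<zero>" for m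
    proof -
      have "p m \<noteq> \<zero> \<or> q m \<noteq> \<zero>" using that by (auto simp: add)
      then show ?thesis using D(3) \<open>p \<in> carrier ?M\<close> \<open>q \<in> carrier ?M\<close> by blast
    qed
  qed (use that D in \<open>auto simp: add\<close>)
  have smult_c: "c \<odot>\<^bsub>?M\<^esub> p \<in> carrier ?M" if "c \<in> carrier R" "p \<in> carrier ?M" for c p
  proof (rule mpoly_carrierI[of _ "{m. p m \<noteq> \<zero>}"])
    show "m \<in> {m. p m \<noteq> \<zero>} \<and> set_mset m \<subseteq> V" if "(c \<odot>\<^bsub>?M\<^esub> p) m \<noteq> \<zero>" for m
    proof -
      have "p m \<noteq> \<zero>" using that \<open>c \<in> carrier R\<close> by (auto simp: smult)
      then show ?thesis using D(3) \<open>p \<in> carrier ?M\<close> by blast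
    qed
  qed (use that D in \<open>auto simp: smult\<close>)
  have mult_c: "p \<otimes>\<^bsub>?M\<^esub> q \<in> carrier ?M" if p: "p \<in> carrier ?M" and q: "q \<in> carrier ?M" for p q
  proof (rule mpoly_carrierI[of _ "(\<lambda>(a, b). a + b) ` ({m. p m \<noteq> \<zero>} \<times> {m. q m \<noteq> \<zero>})"])
    show "(p \<otimes>\<^bsub>?M\<^esub> q) m \<in> carrier R" for m
      using D(1)[OF p] D(1)[OF q] by (auto simp: mult intro!: finsum_closed)
    show "m \<in> (\<lambda>(a, b). a + b) ` ({m. p m \<noteq> \<zero>} \<times> {m. q m \<noteq> \<zero>}) \<and> set_mset m \<subseteq> V"
      if "(p \<otimes>\<^bsub>?M\<^esub> q) m \<noteq> \<zero>" for m
    proof -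
      have "\<exists>n. n \<subseteq># m \<and> p n \<otimes> q (m - n) \<noteq> \<zero>"
      proof (rule ccontr)
        assume "\<not> ?thesis"
        then have "(p \<otimes>\<^bsub>?M\<^esub> q) m = (\<Oplus>n\<in>{n. n \<subseteq># m}. \<zero>)"
          unfolding mult by (intro finsum_cong') auto
        with that show False by simp
      qed
      then obtain n where n: "n \<subseteq># m" "p n \<otimes> q (m - n) \<noteq> \<zero>" by blast
      then have nz: "p n \<noteq> \<zero>" "q (m - n) \<noteq> \<zero>"
        using D(1)[OF p] D(1)[OF q] by auto
      have m: "m = n + (m - n)" using n(1) by simp
      have "set_mset (n + (m - n)) \<subseteq> V" using D(3)[OF p nz(1)] D(3)[OF q nz(2)] by auto
      with m nz show ?thesis by (auto simp: image_iff)
    qed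
  qed (use D(2)[OF p] D(2)[OF q] in auto)
  have comm: "p \<otimes>\<^bsub>?M\<^esub> q = q \<otimes>\<^bsub>?M\<^esub> p" if p: "p \<in> carrier ?M" and q: "q \<in> carrier ?M" for p q
  proof
    fix m :: "'x multiset"
    note cl = D(1)[OF p] D(1)[OF q]
    have dd: "m - (m - n) = n" if "n \<subseteq># m" for n
      using that by (simp add: multiset_eq_iff subseteq_mset_def)
    have im: "{n. n \<subseteq># m} = (\<lambda>n. m - n) ` {n. n \<subseteq># m}"
      by (auto simp: image_iff) (metis dd diff_subset_eq_self)
    have "(p \<otimes>\<^bsub>?M\<^esub> q) m = (\<Oplus>n\<in>(\<lambda>n. m - n) ` {n. n \<subseteq># m}. p n \<otimes> q (m - n))"
      using im by (simp add: mult)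
    also have "\<dots> = (\<Oplus>n\<in>{n. n \<subseteq># m}. p (m - n) \<otimes> q (m - (m - n)))"
      by (rule finsum_reindex) (use cl in \<open>auto simp: inj_on_def\<close>, metis dd)
    also have "\<dots> = (\<Oplus>n\<in>{n. n \<subseteq># m}. q n \<otimes> p (m - n))"
      by (rule finsum_cong') (use cl in \<open>auto simp: dd m_comm\<close>)
    finally show "(p \<otimes>\<^bsub>?M\<^esub> q) m = (q \<otimes>\<^bsub>?M\<^esub> p) m" by (simp add: mult)
  qed
  have assoc: "(p \<otimes>\<^bsub>?M\<^esub> q) \<otimes>\<^bsub>?M\<^esub> r = p \<otimes>\<^bsub>?M\<^esub> (q \<otimes>\<^bsub>?M\<^esub> r)"
    if p: "p \<in> carrier ?M" and q: "q \<in> carrier ?M" and r: "r \<in> carrier ?M" for p q r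
  proof
    fix m :: "'x multiset"
    note cl = D(1)[OF p] D(1)[OF q] D(1)[OF r]
    have "((p \<otimes>\<^bsub>?M\<^esub> q) \<otimes>\<^bsub>?M\<^esub> r) m =
      (\<Oplus>n\<in>{n. n \<subseteq># m}. \<Oplus>a\<in>{a. a \<subseteq># n}. p a \<otimes> (q (n - a) \<otimes> r (m - (a + (n - a)))))"
      unfolding mult
      by (rule finsum_cong')
        (use cl in \<open>auto simp: finsum_ldistr fs m_assoc intro!: finsum_closed finsum_cong'\<close>)
    also have "\<dots> = (\<Oplus>a\<in>{a. a \<subseteq># m}. \<Oplus>b\<in>{b. b \<subseteq># m - a}. p a \<otimes> (q b \<otimes> r (m - (a + b))))"
      by (rule finsum_triangle[where f = "\<lambda>a b. p a \<otimes> (q b \<otimes> r (m - (a + b)))"]) (use cl in auto)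
    also have "\<dots> = (p \<otimes>\<^bsub>?M\<^esub> (q \<otimes>\<^bsub>?M\<^esub> r)) m"
      unfolding mult
      by (rule finsum_cong')
        (use cl in \<open>auto simp: finsum_rdistr fs intro!: finsum_closed finsum_cong'\<close>)
    finally show "((p \<otimes>\<^bsub>?M\<^esub> q) \<otimes>\<^bsub>?M\<^esub> r) m = (p \<otimes>\<^bsub>?M\<^esub> (q \<otimes>\<^bsub>?M\<^esub> r)) m" .
  qed
  have l_one: "\<one>\<^bsub>?M\<^esub> \<otimes>\<^bsub>?M\<^esub> p = p" if p: "p \<in> carrier ?M" for p
  proof
    fix m :: "'x multiset"
    have "(\<one>\<^bsub>?M\<^esub> \<otimes>\<^bsub>?M\<^esub> p) m = (\<Oplus>n\<in>{n. n \<subseteq># m}. if {#} = n then p (m - n) else \<zero>)"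
      unfolding mult by (rule finsum_cong') (use D(1)[OF p] in \<open>auto simp: one\<close>)
    also have "\<dots> = p (m - {#})"
      by (rule add.finprod_singleton) (use D(1)[OF p] in \<open>auto simp: fs\<close>)
    finally show "(\<one>\<^bsub>?M\<^esub> \<otimes>\<^bsub>?M\<^esub> p) m = p m" by simp
  qed
  have distr: "(p \<oplus>\<^bsub>?M\<^esub> q) \<otimes>\<^bsub>?M\<^esub> r = p \<otimes>\<^bsub>?M\<^esub> r \<oplus>\<^bsub>?M\<^esub> q \<otimes>\<^bsub>?M\<^esub> r"
    if p: "p \<in> carrier ?M" and q: "q \<in> carrier ?M" and r: "r \<in> carrier ?M" for p q r
  proof
    fix m :: "'x multiset"
    note cl = D(1)[OF p] D(1)[OF q] D(1)[OF r]
    have "((p \<oplus>\<^bsub>?M\<^esub> q) \<otimes>\<^bsub>?M\<^esub> r) m =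
        (\<Oplus>n\<in>{n. n \<subseteq># m}. p n \<otimes> r (m - n) \<oplus> q n \<otimes> r (m - n))"
      unfolding mult by (rule finsum_cong') (use cl in \<open>auto simp: add l_distr\<close>)
    then show "((p \<oplus>\<^bsub>?M\<^esub> q) \<otimes>\<^bsub>?M\<^esub> r) m = (p \<otimes>\<^bsub>?M\<^esub> r \<oplus>\<^bsub>?M\<^esub> q \<otimes>\<^bsub>?M\<^esub> r) m"
      using cl by (simp add: finsum_addf mult add Pi_def)
  qed
  show "cring R" by (rule is_cring)
  show "a \<odot>\<^bsub>?M\<^esub> x \<in> carrier ?M" if "a \<in> carrier R" "x \<in> carrier ?M" for a x
    using that by (rule smult_c)
  have grp: "abelian_group ?M"
  proof (rule abelian_groupI)
    fix p assume p: "p \<in> carrier ?M"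
    have "(\<lambda>m. \<ominus> p m) \<in> carrier ?M"
    proof (rule mpoly_carrierI[of _ "{m. p m \<noteq> \<zero>}"])
      show "m \<in> {m. p m \<noteq> \<zero>} \<and> set_mset m \<subseteq> V" if "\<ominus> p m \<noteq> \<zero>" for m
        using that D(3)[OF p, of m] by fastforce
    qed (use D[OF p] in auto)
    moreover have "(\<lambda>m. \<ominus> p m) \<oplus>\<^bsub>?M\<^esub> p = \<zero>\<^bsub>?M\<^esub>"
      using D(1)[OF p] by (auto simp: fun_eq_iff add zero l_neg)
    ultimately show "\<exists>y\<in>carrier ?M. y \<oplus>\<^bsub>?M\<^esub> p = \<zero>\<^bsub>?M\<^esub>" by blast
  qed (use D(1) in \<open>auto simp: fun_eq_iff add zero add_c zero_c a_ac\<close>)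
  show "cring ?M"
    by (rule cringI[OF grp comm_monoidI])
      (simp_all add: mult_c one_c assoc l_one distr, (rule comm; assumption)?)
  show "a \<odot>\<^bsub>?M\<^esub> x \<otimes>\<^bsub>?M\<^esub> y = a \<odot>\<^bsub>?M\<^esub> (x \<otimes>\<^bsub>?M\<^esub> y)"
    if a: "a \<in> carrier R" and x: "x \<in> carrier ?M" and y: "y \<in> carrier ?M" for a x y
  proof
    fix m :: "'x multiset"
    note cl = D(1)[OF x] D(1)[OF y]
    have "(a \<odot>\<^bsub>?M\<^esub> x \<otimes>\<^bsub>?M\<^esub> y) m = (\<Oplus>n\<in>{n. n \<subseteq># m}. a \<otimes> (x n \<otimes> y (m - n)))"
      unfolding mult by (rule finsum_cong') (use cl a in \<open>auto simp: smult m_assoc\<close>)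
    also have "\<dots> = a \<otimes> (x \<otimes>\<^bsub>?M\<^esub> y) m"
      unfolding mult by (subst finsum_rdistr) (use cl a fs in auto)
    finally show "(a \<odot>\<^bsub>?M\<^esub> x \<otimes>\<^bsub>?M\<^esub> y) m = (a \<odot>\<^bsub>?M\<^esub> (x \<otimes>\<^bsub>?M\<^esub> y)) m" by (simp add: smult)
  qed
qed (use mpoly_carrierD(1)[of _ V] in \<open>auto simp: mpoly_def indexed_padd_def fun_eq_iff l_distr r_distr m_assoc\<close>)

end


section \<open>Differential and integro-differential algebras\<close>

text \<open>The library locale \<^locale>\<open>algebra\<close> is about commutative unital associative algebras.
  The weight is \<open>w\<close>, and \<open>P\<close> is the integral operator \<open>\<Pi>\<close>.\<close>

locale comm_diff_algebra = algebra R M for R (structure) and M (structure) +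
  fixes w :: 'a and d :: "'c \<Rightarrow> 'c"
  assumes weight_closed: "w \<in> carrier R"
    and d_closed: "x \<in> carrier M \<Longrightarrow> d x \<in> carrier M"
    and d_add: "\<lbrakk>x \<in> carrier M; y \<in> carrier M\<rbrakk> \<Longrightarrow> d (x \<oplus>\<^bsub>M\<^esub> y) = d x \<oplus>\<^bsub>M\<^esub> d y"
    and d_smult: "\<lbrakk>c \<in> carrier R; x \<in> carrier M\<rbrakk> \<Longrightarrow> d (c \<odot>\<^bsub>M\<^esub> x) = c \<odot>\<^bsub>M\<^esub> d x"
    and d_mult: "\<lbrakk>x \<in> carrier M; y \<in> carrier M\<rbrakk> \<Longrightarrow>
      d (x \<otimes>\<^bsub>M\<^esub> y) = d x \<otimes>\<^bsub>M\<^esub> y \<oplus>\<^bsub>M\<^esub> x \<otimes>\<^bsub>M\<^esub> d y \<oplus>\<^bsub>M\<^esub> w \<odot>\<^bsub>M\<^esub> (d x \<otimes>\<^bsub>M\<^esub> d y)"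
    and d_one: "d \<one>\<^bsub>M\<^esub> = \<zero>\<^bsub>M\<^esub>"

locale comm_integro_diff_algebra = comm_diff_algebra R M w D
  for R (structure) and M (structure) and w and D +
  fixes P :: "'c \<Rightarrow> 'c"
  assumes P_closed: "x \<in> carrier M \<Longrightarrow> P x \<in> carrier M"
    and P_add: "\<lbrakk>x \<in> carrier M; y \<in> carrier M\<rbrakk> \<Longrightarrow> P (x \<oplus>\<^bsub>M\<^esub> y) = P x \<oplus>\<^bsub>M\<^esub> P y"
    and P_smult: "\<lbrakk>c \<in> carrier R; x \<in> carrier M\<rbrakk> \<Longrightarrow> P (c \<odot>\<^bsub>M\<^esub> x) = c \<odot>\<^bsub>M\<^esub> P x"
    and D_P: "x \<in> carrier M \<Longrightarrow> D (P x) = x"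
    and P_D_mult: "\<lbrakk>x \<in> carrier M; y \<in> carrier M\<rbrakk> \<Longrightarrow>
      P (D x) \<otimes>\<^bsub>M\<^esub> P (D y) = (P (D x) \<otimes>\<^bsub>M\<^esub> y \<oplus>\<^bsub>M\<^esub> x \<otimes>\<^bsub>M\<^esub> P (D y)) \<ominus>\<^bsub>M\<^esub> P (D (x \<otimes>\<^bsub>M\<^esub> y))"

definition algebra_hom ::
    "('k, 'm) ring_scheme \<Rightarrow> ('k, 'a) module \<Rightarrow> ('k, 'b) module \<Rightarrow> ('a \<Rightarrow> 'b) set" where
  "algebra_hom k A B =
    {f \<in> ring_hom A B. \<forall>c\<in>carrier k. \<forall>x\<in>carrier A. f (c \<odot>\<^bsub>A\<^esub> x) = c \<odot>\<^bsub>B\<^esub> f x}"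

definition diff_hom ::
    "('k, 'm) ring_scheme \<Rightarrow> ('k, 'a) module \<Rightarrow> ('a \<Rightarrow> 'a) \<Rightarrow> ('k, 'b) module \<Rightarrow> ('b \<Rightarrow> 'b) \<Rightarrow>
      ('a \<Rightarrow> 'b) set" where
  "diff_hom k A dA B dB = {f \<in> algebra_hom k A B. \<forall>x\<in>carrier A. f (dA x) = dB (f x)}"

definition integro_diff_hom ::
    "('k, 'm) ring_scheme \<Rightarrow> ('k, 'a) module \<Rightarrow> ('a \<Rightarrow> 'a) \<Rightarrow> ('a \<Rightarrow> 'a) \<Rightarrow>
      ('k, 'b) module \<Rightarrow> ('b \<Rightarrow> 'b) \<Rightarrow> ('b \<Rightarrow> 'b) \<Rightarrow> ('a \<Rightarrow> 'b) set" where
  "integro_diff_hom k A dA pA B dB pB =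
    {f \<in> diff_hom k A dA B dB. \<forall>x\<in>carrier A. f (pA x) = pB (f x)}"


section \<open>Free commutative integro-differential algebras\<close>

text \<open>
  \<open>free_comm_integro_diff TYPE('r) k w A d F D P i\<close>: the commutative integro-differential algebra
  \<open>(F, D, P)\<close> with \<open>i : A \<rightarrow> F\<close> is free on the differential algebra \<open>(A, d)\<close>, where the test
  algebras \<open>R\<close> are those whose elements belong to the type \<open>'r\<close>. A formula cannot quantify over
  types; freeness in the unrestricted sense means that this holds for every \<open>'r\<close>, so assuming it for
  particular types \<open>'r\<close> assumes less. Such types must not be too small: when nothing is known about
  test algebras living in \<open>'f\<close>, \<open>F\<close> need not be free. For \<open>A = k{u}\<close>, freeness for \<open>'f\<close> and for
  \<open>nat \<Rightarrow> 'k\<close> is enough, as the free algebra is a free \<open>k\<close>-module with a countable basis and so has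
  a copy in \<open>nat \<Rightarrow> 'k\<close>: a copy \<open>M\<close> receives a map from \<open>F\<close>, and the composite \<open>F \<rightarrow> M \<rightarrow> F\<close> is the
  identity by uniqueness for \<open>F\<close> as a test algebra. Homomorphisms matter only on the carrier, hence
  the form of the uniqueness clause.
\<close>

definition free_comm_integro_diff ::
    "'r itself \<Rightarrow> ('k, 'm) ring_scheme \<Rightarrow> 'k \<Rightarrow> ('k, 'a) module \<Rightarrow> ('a \<Rightarrow> 'a) \<Rightarrow>
      ('k, 'f) module \<Rightarrow> ('f \<Rightarrow> 'f) \<Rightarrow> ('f \<Rightarrow> 'f) \<Rightarrow> ('a \<Rightarrow> 'f) \<Rightarrow> bool" where
  "free_comm_integro_diff (_ :: 'r itself) k w A d F D P i \<longleftrightarrow>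
    comm_integro_diff_algebra k F w D P \<and>
    i \<in> diff_hom k A d F D \<and>
    (\<forall>(R :: ('k, 'r) module) DR PR f.
      comm_integro_diff_algebra k R w DR PR \<longrightarrow>
      f \<in> diff_hom k A d R DR \<longrightarrow>
      (\<exists>g \<in> integro_diff_hom k F D P R DR PR.
        (\<forall>a\<in>carrier A. g (i a) = f a) \<and>
        (\<forall>h \<in> integro_diff_hom k F D P R DR PR.
          (\<forall>a\<in>carrier A. h (i a) = f a) \<longrightarrow> (\<forall>x\<in>carrier F. h x = g x))))"

end

theory Submission
  imports Defs "HOL-Library.Countable_Set"
begin

text \<open>
  In an integro-differential algebra \<open>e = id - P D\<close> is an algebra endomorphism with values in the
  constants. Conversely, a differential algebra with surjective derivation \<open>D\<close> and an idempotent
  endomorphism \<open>e\<close> whose image is \<open>ker D\<close> has a unique integral \<open>P\<close> with \<open>P D = id - e\<close>. Therefore it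
  suffices to adjoin to \<open>k{u}\<close> new variables, namely the constants \<open>e(u\<^sub>i)\<close> and iteratively
  integrals of monomials, until \<open>D\<close> is surjective, without creating further constants; the
  resulting polynomial algebra \<open>M\<close> is then free, since the image of each variable in a test algebra
  is forced.

  Which monomials need an integral is decided by leading terms: for a suitable order on the variables,
  the leading monomial of \<open>D(m)\<close> arises from \<open>m\<close> by differentiating its least nonconstant variable \<open>v\<close>
  once, and its coefficient is the exponent of \<open>v\<close>, a unit since \<open>k\<close> contains the rationals. The
  terms in which the weight occurs are all smaller. One integral is adjoined for every monomial that
  is not leading in this sense, which makes the leading-monomial map a bijection from the nonconstant
  monomials onto all monomials.
\<close>

section \<open>Linear maps and homomorphisms on polynomial algebras\<close>

text \<open>The weight dictates the direction of the order. In \<open>D(u\<^sub>0\<^sup>2) = 2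
  u\<^sub>0 u\<^sub>1 + \<lambda> u\<^sub>1\<^sup>2\<close> the coefficient \<open>\<lambda>\<close>
  may be zero or a non-unit, so the term with two differentiated factors must not lead; hence
  \<open>u\<^sub>1\<close> has to lie below \<open>u\<^sub>0\<close>. Exchanging a letter for
  smaller ones costs least at the least letter, which is why that letter is the one differentiated
  in the leading term. The price is the infinite descent along the \<open>u\<^sub>i\<close>. The
  bijection serves twice. That every monomial leads allows solving \<open>D y = x\<close> by
  reduction; that it leads only once prevents leading terms from cancelling, so a polynomial with
  zero derivative involves constants only. Whether \<open>s\<close> needs an integral depends on
  which smaller integrals exist. The condition in \<open>good\<close> therefore ranges over all
  conceivable \<open>v\<close>, adjoined or not, which keeps the definition inductive; an argument
  by minimal weight shows that enough integrals remain.\<close>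

definition mmon :: "('k, 'm) ring_scheme \<Rightarrow> 'x multiset \<Rightarrow> 'x multiset \<Rightarrow> 'k" where
  "mmon k m = (\<lambda>n. if n = m then \<one>\<^bsub>k\<^esub> else \<zero>\<^bsub>k\<^esub>)"

definition linear_map ::
    "('k, 'm) ring_scheme \<Rightarrow> ('k, 'a, 'p) module_scheme \<Rightarrow> ('k, 'b, 'q) module_scheme \<Rightarrow>
      ('a \<Rightarrow> 'b) \<Rightarrow> bool" where
  "linear_map k A B f \<longleftrightarrow> (\<forall>x\<in>carrier A. f x \<in> carrier B) \<and>
    (\<forall>x\<in>carrier A. \<forall>y\<in>carrier A. f (x \<oplus>\<^bsub>A\<^esub> y) = f x \<oplus>\<^bsub>B\<^esub> f y) \<and>
    (\<forall>c\<in>carrier k. \<forall>x\<in>carrier A. f (c \<odot>\<^bsub>A\<^esub> x) = c \<odot>\<^bsub>B\<^esub> f x)"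

lemma linear_mapD:
  assumes "linear_map k A B f"
  shows "x \<in> carrier A \<Longrightarrow> f x \<in> carrier B"
    and "x \<in> carrier A \<Longrightarrow> y \<in> carrier A \<Longrightarrow> f (x \<oplus>\<^bsub>A\<^esub> y) = f x \<oplus>\<^bsub>B\<^esub> f y"
    and "c \<in> carrier k \<Longrightarrow> x \<in> carrier A \<Longrightarrow> f (c \<odot>\<^bsub>A\<^esub> x) = c \<odot>\<^bsub>B\<^esub> f x"
  using assms by (auto simp: linear_map_def)

lemma linear_mapI:
  assumes "\<And>x. x \<in> carrier A \<Longrightarrow> f x \<in> carrier B"
    and "\<And>x y. x \<in> carrier A \<Longrightarrow> y \<in> carrier A \<Longrightarrow> f (x \<oplus>\<^bsub>A\<^esub> y) = f x \<oplus>\<^bsub>B\<^esub> f y"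
    and "\<And>c x. c \<in> carrier k \<Longrightarrow> x \<in> carrier A \<Longrightarrow> f (c \<odot>\<^bsub>A\<^esub> x) = c \<odot>\<^bsub>B\<^esub> f x"
  shows "linear_map k A B f"
  using assms by (auto simp: linear_map_def)

lemma linear_map_comp:
  "linear_map k A B f \<Longrightarrow> linear_map k B C g \<Longrightarrow> linear_map k A C (\<lambda>x. g (f x))"
  by (auto simp: linear_map_def)

lemma (in algebra) linear_map_mult_left:
  "y \<in> carrier M \<Longrightarrow> linear_map R M M (\<lambda>x. x \<otimes>\<^bsub>M\<^esub> y)"
  by (auto simp: linear_map_def l_distr smult_assoc2)

lemma (in algebra) smult_assoc3:
  assumes "c \<in> carrier R" "x \<in> carrier M" "y \<in> carrier M"
  shows "x \<otimes>\<^bsub>M\<^esub> (c \<odot>\<^bsub>M\<^esub> y) = c \<odot>\<^bsub>M\<^esub> (x \<otimes>\<^bsub>M\<^esub> y)"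
  using assms by (simp add: m_comm[of x] smult_assoc2)

lemma (in algebra) smult_eq_mult:
  assumes "c \<in> carrier R" "x \<in> carrier M"
  shows "c \<odot>\<^bsub>M\<^esub> x = (c \<odot>\<^bsub>M\<^esub> \<one>\<^bsub>M\<^esub>) \<otimes>\<^bsub>M\<^esub> x"
  using assms by (simp add: smult_assoc2)

lemma (in algebra) linear_map_mult_right:
  "y \<in> carrier M \<Longrightarrow> linear_map R M M (\<lambda>x. y \<otimes>\<^bsub>M\<^esub> x)"
  by (auto simp: linear_map_def r_distr smult_assoc3)

lemma (in algebra) linear_map_smult:
  "c \<in> carrier R \<Longrightarrow> linear_map R M M (\<lambda>x. c \<odot>\<^bsub>M\<^esub> x)"
  by (auto simp: linear_map_def smult_r_distr smult_assoc1[symmetric] R.m_comm)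

lemma (in algebra) linear_map_add:
  assumes "linear_map R A M f" "linear_map R A M g"
  shows "linear_map R A M (\<lambda>x. f x \<oplus>\<^bsub>M\<^esub> g x)"
  using assms by (auto simp: linear_map_def M.a_ac smult_r_distr)

lemma algebra_hom_linear: "f \<in> algebra_hom k A B \<Longrightarrow> linear_map k A B f"
  by (auto simp: linear_map_def algebra_hom_def ring_hom_def)

lemma algebra_homD:
  assumes "f \<in> algebra_hom k A B"
  shows "x \<in> carrier A \<Longrightarrow> f x \<in> carrier B"
    and "x \<in> carrier A \<Longrightarrow> y \<in> carrier A \<Longrightarrow> f (x \<oplus>\<^bsub>A\<^esub> y) = f x \<oplus>\<^bsub>B\<^esub> f y"
    and "x \<in> carrier A \<Longrightarrow> y \<in> carrier A \<Longrightarrow> f (x \<otimes>\<^bsub>A\<^esub> y) = f x \<otimes>\<^bsub>B\<^esub> f y"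
    and "c \<in> carrier k \<Longrightarrow> x \<in> carrier A \<Longrightarrow> f (c \<odot>\<^bsub>A\<^esub> x) = c \<odot>\<^bsub>B\<^esub> f x"
    and "f \<one>\<^bsub>A\<^esub> = \<one>\<^bsub>B\<^esub>"
  using assms by (auto simp: algebra_hom_def ring_hom_def)

lemma algebra_homI:
  assumes "linear_map k A B f"
    and "\<And>x y. x \<in> carrier A \<Longrightarrow> y \<in> carrier A \<Longrightarrow> f (x \<otimes>\<^bsub>A\<^esub> y) = f x \<otimes>\<^bsub>B\<^esub> f y"
    and "f \<one>\<^bsub>A\<^esub> = \<one>\<^bsub>B\<^esub>"
  shows "f \<in> algebra_hom k A B"
  using assms by (auto simp: algebra_hom_def ring_hom_def linear_map_def)

lemma algebra_hom_comp:
  "f \<in> algebra_hom k A B \<Longrightarrow> g \<in> algebra_hom k B C \<Longrightarrow> (\<lambda>x. g (f x)) \<in> algebra_hom k A C"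
  by (auto simp: algebra_hom_def ring_hom_def Pi_def)

section \<open>Coefficients and monomials of polynomial algebras\<close>

context cring
begin

lemma mpoly_coeff:
  shows "(p \<oplus>\<^bsub>mpoly R V\<^esub> q) m = p m \<oplus> q m"
    and "(c \<odot>\<^bsub>mpoly R V\<^esub> p) m = c \<otimes> p m"
    and "\<zero>\<^bsub>mpoly R V\<^esub> m = \<zero>"
  by (simp_all add: mpoly_def indexed_padd_def indexed_const_def)

lemma mpoly_one: "\<one>\<^bsub>mpoly R V\<^esub> = mmon R {#}"
  by (simp add: mpoly_def indexed_const_def mmon_def)

lemma mpoly_mult: "(p \<otimes>\<^bsub>mpoly R V\<^esub> q) m = (\<Oplus>n\<in>{n. n \<subseteq># m}. p n \<otimes> q (m - n))"
  by (simp add: mpoly_def)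

lemma indexed_var_mmon: "indexed_var x = mmon R {#x#}"
  by (auto simp: indexed_var_def indexed_pmult_def indexed_const_def mmon_def fun_eq_iff)
    (metis insert_DiffM)

lemma mmon_closed: "set_mset m \<subseteq> V \<Longrightarrow> mmon R m \<in> carrier (mpoly R V)"
  using mpoly_monom[of \<one> m V] by (simp add: mmon_def mpoly_def)

lemma mpoly_mono: "V \<subseteq> W \<Longrightarrow> p \<in> carrier (mpoly R V) \<Longrightarrow> p \<in> carrier (mpoly R W)"
  by (rule mpoly_carrierI[of _ "{m. p m \<noteq> \<zero>}"]) (use mpoly_carrierD[of p V] in auto)

lemma mpoly_a_inv:
  assumes "p \<in> carrier (mpoly R V)"
  shows "(\<ominus>\<^bsub>mpoly R V\<^esub> p) m = \<ominus> p m"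
proof -
  interpret A: algebra R "mpoly R V" by (rule algebra_mpoly)
  have "(\<ominus>\<^bsub>mpoly R V\<^esub> p \<oplus>\<^bsub>mpoly R V\<^esub> p) m = \<zero>" using assms by (simp add: A.M.l_neg mpoly_coeff)
  then show ?thesis using assms
    by (simp add: mpoly_coeff mpoly_carrierD(1)[of _ V] minus_equality)
qed

lemma mmon_mult_coeff:
  assumes p: "\<And>m. p m \<in> carrier R"
  shows "(mmon R n \<otimes>\<^bsub>mpoly R V\<^esub> p) m = (if n \<subseteq># m then p (m - n) else \<zero>)"
proof -
  have "(mmon R n \<otimes>\<^bsub>mpoly R V\<^esub> p) m =
      (\<Oplus>a\<in>{a. a \<subseteq># m}. if n = a then p (m - a) else \<zero>)"
    unfolding mpoly_mult by (rule finsum_cong') (use p in \<open>auto simp: mmon_def\<close>)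
  also have "\<dots> = (if n \<subseteq># m then p (m - n) else \<zero>)"
  proof (cases "n \<subseteq># m")
    case True
    then show ?thesis
      by simp (rule add.finprod_singleton, use p finite_submultisets in auto)
  next
    case False
    then have "(\<Oplus>a\<in>{a. a \<subseteq># m}. if n = a then p (m - a) else \<zero>) = (\<Oplus>a\<in>{a. a \<subseteq># m}. \<zero>)"
      by (intro finsum_cong') auto
    then show ?thesis using False by simp
  qed
  finally show ?thesis .
qed

lemma mmon_mult: "mmon R m \<otimes>\<^bsub>mpoly R V\<^esub> mmon R n = mmon R (m + n)"
proof
  fix q
  show "(mmon R m \<otimes>\<^bsub>mpoly R V\<^esub> mmon R n) q = mmon R (m + n) q"
    by (subst mmon_mult_coeff) (auto simp: mmon_def)
qed

lemma mpoly_finsum_coeff: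
  assumes "finite A" "\<And>a. a \<in> A \<Longrightarrow> f a \<in> carrier (mpoly R V)"
  shows "(\<Oplus>\<^bsub>mpoly R V\<^esub>a\<in>A. f a) m = (\<Oplus>a\<in>A. f a m)"
proof -
  interpret A: algebra R "mpoly R V" by (rule algebra_mpoly)
  show ?thesis using assms
  proof (induction A rule: finite_induct)
    case empty
    then show ?case by (simp add: mpoly_coeff)
  next
    case (insert x A)
    then show ?case by (simp add: mpoly_coeff Pi_def mpoly_carrierD(1)[of _ V])
  qed
qed

lemma mpoly_expand:
  assumes p: "p \<in> carrier (mpoly R V)"
  shows "p = (\<Oplus>\<^bsub>mpoly R V\<^esub>m\<in>{m. p m \<noteq> \<zero>}. p m \<odot>\<^bsub>mpoly R V\<^esub> mmon R m)"
proof
  fix q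
  interpret A: algebra R "mpoly R V" by (rule algebra_mpoly)
  note D = mpoly_carrierD[OF p]
  have "(\<Oplus>\<^bsub>mpoly R V\<^esub>m\<in>{m. p m \<noteq> \<zero>}. p m \<odot>\<^bsub>mpoly R V\<^esub> mmon R m) q =
      (\<Oplus>m\<in>{m. p m \<noteq> \<zero>}. if q = m then p m else \<zero>)"
    using D
    by (subst mpoly_finsum_coeff)
      (auto simp: mmon_closed mpoly_coeff intro!: finsum_cong', auto simp: mmon_def)
  also have "\<dots> = p q"
  proof (cases "p q = \<zero>")
    case True
    then have "(\<Oplus>m\<in>{m. p m \<noteq> \<zero>}. if q = m then p m else \<zero>) = (\<Oplus>m\<in>{m. p m \<noteq> \<zero>}. \<zero>)"
      by (intro finsum_cong') auto
    then show ?thesis using True by simp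
  next
    case False
    then show ?thesis using D by (intro add.finprod_singleton) auto
  qed
  finally show "p q = (\<Oplus>\<^bsub>mpoly R V\<^esub>m\<in>{m. p m \<noteq> \<zero>}. p m \<odot>\<^bsub>mpoly R V\<^esub> mmon R m) q" ..
qed

text \<open>The monomial case is restricted to the terms of \<open>p\<close> itself.
  \<open>D_surj\<close> needs this: there only the monomials occurring in a remainder are known to
  lie in the image of \<open>D\<close>.\<close>

lemma mpoly_linear_induct [consumes 1, case_names monom zero add]:
  assumes p: "p \<in> carrier (mpoly R V)"
    and monom: "\<And>m. p m \<noteq> \<zero> \<Longrightarrow> set_mset m \<subseteq> V \<Longrightarrow> Q (p m \<odot>\<^bsub>mpoly R V\<^esub> mmon R m)"
    and zero: "Q \<zero>\<^bsub>mpoly R V\<^esub>"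
    and add: "\<And>x y. \<lbrakk>x \<in> carrier (mpoly R V); y \<in> carrier (mpoly R V); Q x; Q y\<rbrakk> \<Longrightarrow>
      Q (x \<oplus>\<^bsub>mpoly R V\<^esub> y)"
  shows "Q p"
proof -
  interpret A: algebra R "mpoly R V" by (rule algebra_mpoly)
  note D = mpoly_carrierD[OF p]
  have "Q (\<Oplus>\<^bsub>mpoly R V\<^esub>m\<in>S. p m \<odot>\<^bsub>mpoly R V\<^esub> mmon R m)" if "finite S" "S \<subseteq> {m. p m \<noteq> \<zero>}" for S
    using that
  proof (induction S rule: finite_induct)
    case empty
    then show ?case using zero by simp
  next
    case (insert m S)
    have c: "p n \<odot>\<^bsub>mpoly R V\<^esub> mmon R n \<in> carrier (mpoly R V)" if "n \<in> insert m S" for n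
      using insert that D by (auto simp: mmon_closed)
    then have "Q (p m \<odot>\<^bsub>mpoly R V\<^esub> mmon R m \<oplus>\<^bsub>mpoly R V\<^esub> (\<Oplus>\<^bsub>mpoly R V\<^esub>m\<in>S. p m \<odot>\<^bsub>mpoly R V\<^esub> mmon R m))"
      using insert D by (intro add monom A.M.finsum_closed) auto
    then show ?case using insert c by (subst A.M.finsum_insert) auto
  qed
  from this[OF D(2) subset_refl] show ?thesis using mpoly_expand[OF p] by simp
qed

end

lemma (in algebra) linear_map_zero:
  assumes "linear_map R A M f" "algebra R A"
  shows "f \<zero>\<^bsub>A\<^esub> = \<zero>\<^bsub>M\<^esub>"
proof -
  interpret A: algebra R A by fact
  have "f (\<zero> \<odot>\<^bsub>A\<^esub> \<zero>\<^bsub>A\<^esub>) = \<zero> \<odot>\<^bsub>M\<^esub> f \<zero>\<^bsub>A\<^esub>" using linear_mapD[OF assms(1)] by blast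
  then show ?thesis using linear_mapD(1)[OF assms(1)] by simp
qed

lemma (in algebra) linear_map_minus:
  assumes "linear_map R A M f" "algebra R A" "x \<in> carrier A" "y \<in> carrier A"
  shows "f (x \<ominus>\<^bsub>A\<^esub> y) = f x \<ominus>\<^bsub>M\<^esub> f y"
proof -
  interpret A: algebra R A by fact
  note L = linear_mapD[OF assms(1)]
  have "f x = f ((x \<ominus>\<^bsub>A\<^esub> y) \<oplus>\<^bsub>A\<^esub> y)" using assms by (simp add: A.M.minus_eq A.M.a_assoc A.M.l_neg)
  also have "\<dots> = f (x \<ominus>\<^bsub>A\<^esub> y) \<oplus>\<^bsub>M\<^esub> f y" using assms by (intro L) auto
  finally show ?thesis using L(1) assms
    by (simp add: M.minus_eq M.a_assoc M.r_neg)
qed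

section \<open>Linear extension and evaluation\<close>

context algebra
begin

lemma mpoly_linear_eqI:
  assumes f: "linear_map R (mpoly R V) M f" and g: "linear_map R (mpoly R V) M g"
    and eq: "\<And>m. set_mset m \<subseteq> V \<Longrightarrow> f (mmon R m) = g (mmon R m)"
    and p: "p \<in> carrier (mpoly R V)"
  shows "f p = g p"
  using p
proof (induction rule: R.mpoly_linear_induct)
  case (monom m)
  then show ?case
    using linear_mapD(3)[OF f, of "p m" "mmon R m"] linear_mapD(3)[OF g, of "p m" "mmon R m"]
      eq[of m] R.mpoly_carrierD(1)[OF p] R.mmon_closed[of m V] by simp
next
  case zero
  show ?case using linear_map_zero f g R.algebra_mpoly by metis
next
  case (add x y)
  then show ?case using linear_mapD(2)[OF f] linear_mapD(2)[OF g] by simp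
qed

text \<open>The linear extension of \<open>t\<close> from monomials to polynomials. The set of
  variables does not enter, so the same map can be regarded on a polynomial algebra in fewer
  variables, as in \<open>D_ker_E\<close>.\<close>

definition mlin :: "('x multiset \<Rightarrow> 'c) \<Rightarrow> ('x multiset \<Rightarrow> 'a) \<Rightarrow> 'c" where
  "mlin t p = (\<Oplus>\<^bsub>M\<^esub>m\<in>{m. p m \<noteq> \<zero>}. p m \<odot>\<^bsub>M\<^esub> t m)"

lemma mlin_superset:
  assumes "finite S" "{m. p m \<noteq> \<zero>} \<subseteq> S" "\<And>m. p m \<in> carrier R" "\<And>m. m \<in> S \<Longrightarrow> t m \<in> carrier M"
  shows "mlin t p = (\<Oplus>\<^bsub>M\<^esub>m\<in>S. p m \<odot>\<^bsub>M\<^esub> t m)"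
  unfolding mlin_def
  by (rule M.add.finprod_mono_neutral_cong_left) (use assms in auto)

lemma mlin_linear:
  assumes t: "\<And>m. set_mset m \<subseteq> V \<Longrightarrow> t m \<in> carrier M"
  shows "linear_map R (mpoly R V) M (mlin t)"
proof (rule linear_mapI)
  note D = R.mpoly_carrierD[of _ V]
  show "mlin t p \<in> carrier M" if "p \<in> carrier (mpoly R V)" for p
    unfolding mlin_def using D(1,3)[OF that] t by (intro M.finsum_closed) auto
  show "mlin t (p \<oplus>\<^bsub>mpoly R V\<^esub> q) = mlin t p \<oplus>\<^bsub>M\<^esub> mlin t q"
    if p: "p \<in> carrier (mpoly R V)" and q: "q \<in> carrier (mpoly R V)" for p q
  proof -
    let ?S = "{m. p m \<noteq> \<zero>} \<union> {m. q m \<noteq> \<zero>}"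
    have S: "finite ?S" "\<And>m. m \<in> ?S \<Longrightarrow> t m \<in> carrier M"
      using D[OF p] D[OF q] t by auto
    have "mlin t (p \<oplus>\<^bsub>mpoly R V\<^esub> q) = (\<Oplus>\<^bsub>M\<^esub>m\<in>?S. (p m \<oplus> q m) \<odot>\<^bsub>M\<^esub> t m)"
      using S D(1)[OF p] D(1)[OF q] by (subst mlin_superset[of ?S]) (auto simp: R.mpoly_coeff)
    also have "\<dots> = (\<Oplus>\<^bsub>M\<^esub>m\<in>?S. p m \<odot>\<^bsub>M\<^esub> t m \<oplus>\<^bsub>M\<^esub> q m \<odot>\<^bsub>M\<^esub> t m)"
      using S D(1)[OF p] D(1)[OF q] by (intro M.finsum_cong') (auto simp: smult_l_distr)
    also have "\<dots> = (\<Oplus>\<^bsub>M\<^esub>m\<in>?S. p m \<odot>\<^bsub>M\<^esub> t m) \<oplus>\<^bsub>M\<^esub> (\<Oplus>\<^bsub>M\<^esub>m\<in>?S. q m \<odot>\<^bsub>M\<^esub> t m)"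
      using S D(1)[OF p] D(1)[OF q] by (intro M.finsum_addf) auto
    also have "\<dots> = mlin t p \<oplus>\<^bsub>M\<^esub> mlin t q"
      using S D(1)[OF p] D(1)[OF q] by (subst (1 2) mlin_superset[of ?S]) auto
    finally show ?thesis .
  qed
  show "mlin t (c \<odot>\<^bsub>mpoly R V\<^esub> p) = c \<odot>\<^bsub>M\<^esub> mlin t p"
    if c: "c \<in> carrier R" and p: "p \<in> carrier (mpoly R V)" for c p
  proof -
    let ?S = "{m. p m \<noteq> \<zero>}"
    have S: "finite ?S" "\<And>m. m \<in> ?S \<Longrightarrow> t m \<in> carrier M"
      using D[OF p] t by auto
    have "mlin t (c \<odot>\<^bsub>mpoly R V\<^esub> p) = (\<Oplus>\<^bsub>M\<^esub>m\<in>?S. (c \<otimes> p m) \<odot>\<^bsub>M\<^esub> t m)"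
      using S D(1)[OF p] c by (subst mlin_superset[of ?S]) (auto simp: R.mpoly_coeff)
    also have "\<dots> = (\<Oplus>\<^bsub>M\<^esub>m\<in>?S. c \<odot>\<^bsub>M\<^esub> (p m \<odot>\<^bsub>M\<^esub> t m))"
      using S D(1)[OF p] c by (intro M.finsum_cong') (auto simp: smult_assoc1)
    also have "\<dots> = c \<odot>\<^bsub>M\<^esub> mlin t p"
      unfolding mlin_def using S D(1)[OF p] c by (intro finsum_smult_ldistr[symmetric]) auto
    finally show ?thesis .
  qed
qed

lemma mlin_mmon:
  assumes "t m \<in> carrier M"
  shows "mlin t (mmon R m) = t m"
proof -
  have "mlin t (mmon R m) = (\<Oplus>\<^bsub>M\<^esub>n\<in>{m}. mmon R m n \<odot>\<^bsub>M\<^esub> t n)"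
    using assms by (intro mlin_superset) (auto simp: mmon_def)
  then show ?thesis using assms by (simp add: mmon_def)
qed

text \<open>The guard makes the folded function commute on the whole type, as \<^const>\<open>fold_mset\<close> requires.\<close>

definition mprod :: "'c multiset \<Rightarrow> 'c" where
  "mprod = fold_mset (\<lambda>x y. if x \<in> carrier M \<and> y \<in> carrier M then x \<otimes>\<^bsub>M\<^esub> y else y) \<one>\<^bsub>M\<^esub>"

lemma mprod_empty [simp]: "mprod {#} = \<one>\<^bsub>M\<^esub>"
  by (simp add: mprod_def)

lemma mprod_add_mset_guard:
  "mprod (add_mset x m) =
    (if x \<in> carrier M \<and> mprod m \<in> carrier M then x \<otimes>\<^bsub>M\<^esub> mprod m else mprod m)"
proof -
  interpret comp_fun_commute "\<lambda>x y. if x \<in> carrier M \<and> y \<in> carrier M then x \<otimes>\<^bsub>M\<^esub> y else y"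
    by unfold_locales (auto simp: fun_eq_iff m_lcomm)
  show ?thesis unfolding mprod_def by (rule fold_mset_add_mset)
qed

lemma mprod_closed [simp]: "set_mset m \<subseteq> carrier M \<Longrightarrow> mprod m \<in> carrier M"
  by (induction m) (auto simp: mprod_add_mset_guard)

lemma mprod_add_mset [simp]:
  "set_mset (add_mset x m) \<subseteq> carrier M \<Longrightarrow> mprod (add_mset x m) = x \<otimes>\<^bsub>M\<^esub> mprod m"
  by (simp add: mprod_add_mset_guard)

lemma mprod_union:
  "set_mset (m + n) \<subseteq> carrier M \<Longrightarrow> mprod (m + n) = mprod m \<otimes>\<^bsub>M\<^esub> mprod n"
  by (induction m) (auto simp: m_assoc)

definition meval :: "('x \<Rightarrow> 'c) \<Rightarrow> ('x multiset \<Rightarrow> 'a) \<Rightarrow> 'c" where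
  "meval e = mlin (\<lambda>m. mprod (image_mset e m))"

lemma meval_mmon:
  assumes "\<And>x. x \<in># m \<Longrightarrow> e x \<in> carrier M"
  shows "meval e (mmon R m) = mprod (image_mset e m)"
  unfolding meval_def using assms by (intro mlin_mmon mprod_closed) auto

lemma meval_linear:
  assumes e: "\<And>x. x \<in> V \<Longrightarrow> e x \<in> carrier M"
  shows "linear_map R (mpoly R V) M (meval e)"
  unfolding meval_def using e by (intro mlin_linear mprod_closed) auto

lemma meval_one: "meval e \<one>\<^bsub>mpoly R V\<^esub> = \<one>\<^bsub>M\<^esub>"
  using meval_mmon[of "{#}" e] by (simp add: R.mpoly_one)

text \<open>Both sides are linear in each factor, so two passes through
  \<open>mpoly_linear_eqI\<close> reduce the claim to monomials, where it is
  \<open>mprod_union\<close>.\<close>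

lemma meval_mult:
  assumes e: "\<And>x. x \<in> V \<Longrightarrow> e x \<in> carrier M"
    and p: "p \<in> carrier (mpoly R V)" and q: "q \<in> carrier (mpoly R V)"
  shows "meval e (p \<otimes>\<^bsub>mpoly R V\<^esub> q) = meval e p \<otimes>\<^bsub>M\<^esub> meval e q"
proof -
  interpret A: algebra R "mpoly R V" by (rule R.algebra_mpoly)
  note mon = meval_mmon[of _ e]
  note lin = meval_linear[of V e, OF e]
  have mm: "meval e (mmon R m \<otimes>\<^bsub>mpoly R V\<^esub> mmon R n) = meval e (mmon R m) \<otimes>\<^bsub>M\<^esub> meval e (mmon R n)"
    if "set_mset m \<subseteq> V" "set_mset n \<subseteq> V" for m n
  proof -
    have "set_mset (image_mset e m + image_mset e n) \<subseteq> carrier M" using that e by auto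
    then have "mprod (image_mset e m + image_mset e n) = mprod (image_mset e m) \<otimes>\<^bsub>M\<^esub> mprod (image_mset e n)"
      by (rule mprod_union)
    moreover have "x \<in># m \<Longrightarrow> e x \<in> carrier M" "x \<in># n \<Longrightarrow> e x \<in> carrier M" for x using that e by auto
    ultimately show ?thesis by (subst R.mmon_mult, subst (1 2 3) mon) auto
  qed
  have mq: "meval e (mmon R m \<otimes>\<^bsub>mpoly R V\<^esub> q) = meval e (mmon R m) \<otimes>\<^bsub>M\<^esub> meval e q"
    if m: "set_mset m \<subseteq> V" for m
    using linear_map_comp[OF A.linear_map_mult_right lin] linear_map_comp[OF lin linear_map_mult_right] _ q
    by (rule mpoly_linear_eqI) (use m linear_mapD(1)[OF lin] in \<open>auto simp: R.mmon_closed mm\<close>)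
  show ?thesis
    using linear_map_comp[OF A.linear_map_mult_left lin] linear_map_comp[OF lin linear_map_mult_left] _ p
    by (rule mpoly_linear_eqI) (use q linear_mapD(1)[OF lin] in \<open>auto simp: mq\<close>)
qed

lemma meval_var: "e x \<in> carrier M \<Longrightarrow> meval e (mmon R {#x#}) = e x"
  using meval_mmon[of "{#x#}" e] by simp

end

lemma meval_hom:
  assumes "algebra k A" "\<And>x. x \<in> V \<Longrightarrow> e x \<in> carrier A"
  shows "algebra.meval k A e \<in> algebra_hom k (mpoly k V) A"
proof -
  interpret A: algebra k A by fact
  show ?thesis using assms(2)
    by (intro algebra_homI A.meval_linear A.meval_one A.meval_mult)
qed

lemma mpoly_hom_eqI:
  assumes "algebra k A"
    and f: "f \<in> algebra_hom k (mpoly k V) A" and g: "g \<in> algebra_hom k (mpoly k V) A"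
    and eq: "\<And>x. x \<in> V \<Longrightarrow> f (mmon k {#x#}) = g (mmon k {#x#})"
    and p: "p \<in> carrier (mpoly k V)"
  shows "f p = g p"
proof -
  interpret A: algebra k A by fact
  show ?thesis
  proof (rule A.mpoly_linear_eqI[OF _ _ _ p])
    show "f (mmon k m) = g (mmon k m)" if "set_mset m \<subseteq> V" for m
      using that
    proof (induction m)
      case empty
      show ?case using algebra_homD(5)[OF f] algebra_homD(5)[OF g] by (simp add: A.R.mpoly_one)
    next
      case (add x m)
      have "mmon k (add_mset x m) = mmon k {#x#} \<otimes>\<^bsub>mpoly k V\<^esub> mmon k m" by (simp add: A.R.mmon_mult)
      then show ?case using add eq algebra_homD(3)[OF f] algebra_homD(3)[OF g]
        by (simp add: A.R.mmon_closed)
    qed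
  qed (use f g algebra_hom_linear in auto)
qed

section \<open>Weighted derivations of polynomial algebras\<close>

text \<open>The product rule, applied to the letters of a word from left to right.\<close>

primrec lderiv :: "('k, 'm) ring_scheme \<Rightarrow> 'x set \<Rightarrow> 'k \<Rightarrow> ('x \<Rightarrow> 'x multiset \<Rightarrow> 'k) \<Rightarrow> 'x list \<Rightarrow>
    'x multiset \<Rightarrow> 'k" where
  "lderiv k V w \<delta> [] = \<zero>\<^bsub>mpoly k V\<^esub>"
| "lderiv k V w \<delta> (x # xs) = \<delta> x \<otimes>\<^bsub>mpoly k V\<^esub> mmon k (mset xs) \<oplus>\<^bsub>mpoly k V\<^esub>
    (mmon k {#x#} \<oplus>\<^bsub>mpoly k V\<^esub> w \<odot>\<^bsub>mpoly k V\<^esub> \<delta> x) \<otimes>\<^bsub>mpoly k V\<^esub> lderiv k V w \<delta> xs"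

text \<open>The letters of a monomial have no order, so some word representing it is chosen;
  \<open>L_mset\<close> in the next proof shows that for letters in \<open>V\<close> the choice does
  not affect the value.\<close>

definition mderiv :: "('k, 'm) ring_scheme \<Rightarrow> 'x set \<Rightarrow> 'k \<Rightarrow> ('x \<Rightarrow> 'x multiset \<Rightarrow> 'k) \<Rightarrow>
    ('x multiset \<Rightarrow> 'k) \<Rightarrow> 'x multiset \<Rightarrow> 'k" where
  "mderiv k V w \<delta> = algebra.mlin k (mpoly k V) (\<lambda>m. lderiv k V w \<delta> (SOME xs. mset xs = m))"

context cring
begin

text \<open>The product rule extends to concatenated words (\<open>L_append\<close>). By
  commutativity that formula is symmetric in the two words, so a word may be rotated without
  changing its value, and rotations together with induction give invariance under all
  permutations.\<close>

lemma
  fixes V :: "'x set" and \<delta>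
  assumes w: "w \<in> carrier R" and \<delta>: "\<And>x. x \<in> V \<Longrightarrow> \<delta> x \<in> carrier (mpoly R V)"
  shows mderiv_diff: "comm_diff_algebra R (mpoly R V) w (mderiv R V w \<delta>)"
    and mderiv_var: "x \<in> V \<Longrightarrow> mderiv R V w \<delta> (mmon R {#x#}) = \<delta> x"
proof -
  let ?A = "mpoly R V" and ?D = "mderiv R V w \<delta>"
  interpret A: algebra R ?A by (rule algebra_mpoly)
  note mc = mmon_closed[of _ V]
  define L where "L = lderiv R V w \<delta>"
  \<comment> \<open>Scaling by \<open>w\<close> becomes multiplication by an element, which turns
    the identities below into identities of commutative rings.\<close>
  define \<omega> where "\<omega> = w \<odot>\<^bsub>?A\<^esub> \<one>\<^bsub>?A\<^esub>"
  have \<omega>: "\<omega> \<in> carrier ?A" using w by (simp add: \<omega>_def)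
  have w\<omega>: "w \<odot>\<^bsub>?A\<^esub> y = \<omega> \<otimes>\<^bsub>?A\<^esub> y" if "y \<in> carrier ?A" for y
    unfolding \<omega>_def by (rule A.smult_eq_mult[OF w that])
  have Lc: "L xs \<in> carrier ?A" if "set xs \<subseteq> V" for xs
    using that unfolding L_def by (induction xs) (auto simp: mc \<delta> w)
  have L_Nil: "L [] = \<zero>\<^bsub>?A\<^esub>" by (simp add: L_def)
  have L_Cons: "L (x # xs) = \<delta> x \<otimes>\<^bsub>?A\<^esub> mmon R (mset xs) \<oplus>\<^bsub>?A\<^esub>
      (mmon R {#x#} \<oplus>\<^bsub>?A\<^esub> \<omega> \<otimes>\<^bsub>?A\<^esub> \<delta> x) \<otimes>\<^bsub>?A\<^esub> L xs" if "x \<in> V" for x xs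
    using that by (simp add: L_def w\<omega> \<delta>)
  have L_append: "L (xs @ ys) = L xs \<otimes>\<^bsub>?A\<^esub> mmon R (mset ys) \<oplus>\<^bsub>?A\<^esub>
      (mmon R (mset xs) \<oplus>\<^bsub>?A\<^esub> \<omega> \<otimes>\<^bsub>?A\<^esub> L xs) \<otimes>\<^bsub>?A\<^esub> L ys"
    if "set xs \<subseteq> V" "set ys \<subseteq> V" for xs ys
    using that(1)
  proof (induction xs)
    case Nil
    then show ?case using Lc[of ys] that by (simp add: L_Nil mc \<omega> mpoly_one[symmetric, of V])
  next
    case (Cons x xs)
    have c: "L xs \<in> carrier ?A" "L ys \<in> carrier ?A" "mmon R (mset xs) \<in> carrier ?A"
      "mmon R (mset ys) \<in> carrier ?A" "mmon R {#x#} \<in> carrier ?A" "\<delta> x \<in> carrier ?A"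
      using Cons.prems that by (auto simp: Lc mc \<delta>)
    have m: "mmon R (mset (x # xs)) = mmon R {#x#} \<otimes>\<^bsub>?A\<^esub> mmon R (mset xs)"
      "mmon R (mset (xs @ ys)) = mmon R (mset xs) \<otimes>\<^bsub>?A\<^esub> mmon R (mset ys)"
      by (simp_all add: mmon_mult)
    have IH: "L (xs @ ys) = L xs \<otimes>\<^bsub>?A\<^esub> mmon R (mset ys) \<oplus>\<^bsub>?A\<^esub>
      (mmon R (mset xs) \<oplus>\<^bsub>?A\<^esub> \<omega> \<otimes>\<^bsub>?A\<^esub> L xs) \<otimes>\<^bsub>?A\<^esub> L ys" using Cons by auto
    have "x \<in> V" using Cons.prems by simp
    then show ?case using c \<omega>
      unfolding append_Cons L_Cons[OF \<open>x \<in> V\<close>] m IH by algebra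
  qed
  have L_commute: "L (xs @ ys) = L (ys @ xs)" if "set xs \<subseteq> V" "set ys \<subseteq> V" for xs ys
  proof -
    have c: "L xs \<in> carrier ?A" "L ys \<in> carrier ?A" "mmon R (mset xs) \<in> carrier ?A"
      "mmon R (mset ys) \<in> carrier ?A" using that by (auto simp: Lc mc)
    then show ?thesis using \<omega> unfolding L_append[OF that] L_append[OF that(2) that(1)] by algebra
  qed
  have L_mset: "L xs = L ys" if "mset xs = mset ys" "set xs \<subseteq> V" for xs ys
    using that
  proof (induction xs arbitrary: ys)
    case Nil
    then show ?case by simp
  next
    case (Cons x xs)
    have "x \<in> set ys" using Cons.prems(1) by (metis list.set_intros(1) mset_eq_setD)
    \<comment> \<open>Rotating \<open>ys\<close> brings \<open>x\<close> to the front, after which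
      the tails \<open>xs\<close> and \<open>bs @ as\<close> agree by induction.\<close>
    then obtain as bs where ys: "ys = as @ x # bs" by (meson split_list)
    have sub: "set ys \<subseteq> V" using Cons.prems mset_eq_setD by blast
    have m: "mset xs = mset (bs @ as)" using Cons.prems(1) ys by simp
    then have "L xs = L (bs @ as)" using Cons by simp
    then have "L (x # xs) = L (x # bs @ as)" using Cons.prems(2) m by (simp add: L_Cons)
    also have "\<dots> = L ys" using L_commute[of "x # bs" as] sub ys by simp
    finally show ?case .
  qed
  define t where "t m = L (SOME xs. mset xs = m)" for m
  have t_mset: "t (mset xs) = L xs" if "set xs \<subseteq> V" for xs
  proof -
    have "mset (SOME ys. mset ys = mset xs) = mset xs" by (rule someI[of _ xs]) simp
    then show ?thesis unfolding t_def using that L_mset[of xs] by metis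
  qed
  have tc: "t m \<in> carrier ?A" if "set_mset m \<subseteq> V" for m
  proof -
    obtain xs where "m = mset xs" by (metis ex_mset)
    then show ?thesis using that t_mset Lc by simp
  qed
  have t_add: "t (m + n) = t m \<otimes>\<^bsub>?A\<^esub> mmon R n \<oplus>\<^bsub>?A\<^esub>
      (mmon R m \<oplus>\<^bsub>?A\<^esub> \<omega> \<otimes>\<^bsub>?A\<^esub> t m) \<otimes>\<^bsub>?A\<^esub> t n"
    if "set_mset m \<subseteq> V" "set_mset n \<subseteq> V" for m n
  proof -
    obtain xs ys where xy: "m = mset xs" "n = mset ys" by (metis ex_mset)
    then show ?thesis
      using that t_mset[of xs] t_mset[of ys] t_mset[of "xs @ ys"] L_append[of xs ys] by simp
  qed
  have D_def: "?D = A.mlin t" unfolding mderiv_def t_def L_def ..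
  have lin: "linear_map R ?A ?A ?D" unfolding D_def by (rule A.mlin_linear) (rule tc)
  have mon: "?D (mmon R m) = t m" if "set_mset m \<subseteq> V" for m
    unfolding D_def using tc[OF that] by (rule A.mlin_mmon)
  note Dc = linear_mapD(1)[OF lin]
  show "?D (mmon R {#x#}) = \<delta> x" if "x \<in> V" for x
    using mon[of "{#x#}"] t_mset[of "[x]"] that L_Cons[of x "[]"]
    by (simp add: L_Nil \<delta> \<omega> mc mpoly_one[symmetric, of V])
  \<comment> \<open>The right-hand side of the product rule. It is linear in each argument, so only
    monomials have to be checked, where \<open>t_add\<close> applies.\<close>
  let ?r = "\<lambda>p q. ?D p \<otimes>\<^bsub>?A\<^esub> q \<oplus>\<^bsub>?A\<^esub> p \<otimes>\<^bsub>?A\<^esub> ?D q \<oplus>\<^bsub>?A\<^esub> w \<odot>\<^bsub>?A\<^esub> (?D p \<otimes>\<^bsub>?A\<^esub> ?D q)"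
  have linr: "linear_map R ?A ?A (?r p)" if "p \<in> carrier ?A" for p
    using that Dc
    by (intro A.linear_map_add A.linear_map_mult_right linear_map_comp[OF lin A.linear_map_mult_right]
        linear_map_comp[OF linear_map_comp[OF lin A.linear_map_mult_right] A.linear_map_smult] w) auto
  have linl: "linear_map R ?A ?A (\<lambda>p. ?r p q)" if "q \<in> carrier ?A" for q
    using that Dc
    by (intro A.linear_map_add A.linear_map_mult_left linear_map_comp[OF lin A.linear_map_mult_left]
        linear_map_comp[OF linear_map_comp[OF lin A.linear_map_mult_left] A.linear_map_smult] w) auto
  have mm: "?D (mmon R m \<otimes>\<^bsub>?A\<^esub> mmon R n) = ?r (mmon R m) (mmon R n)"
    if "set_mset m \<subseteq> V" "set_mset n \<subseteq> V" for m n
  proof -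
    have c: "t m \<in> carrier ?A" "t n \<in> carrier ?A" "mmon R m \<in> carrier ?A" "mmon R n \<in> carrier ?A"
      using that by (auto simp: tc mc)
    have "set_mset (m + n) \<subseteq> V" using that by simp
    then show ?thesis using c \<omega>
      unfolding mmon_mult mon[OF that(1)] mon[OF that(2)] mon[OF \<open>set_mset (m + n) \<subseteq> V\<close>]
        t_add[OF that] w\<omega>[OF A.m_closed[OF c(1,2)]] by algebra
  qed
  have mq: "?D (mmon R m \<otimes>\<^bsub>?A\<^esub> q) = ?r (mmon R m) q"
    if m: "set_mset m \<subseteq> V" and q: "q \<in> carrier ?A" for m q
    using linear_map_comp[OF A.linear_map_mult_right lin] linr _ q
    by (rule A.mpoly_linear_eqI) (use m in \<open>auto simp: mc mm\<close>)
  show "comm_diff_algebra R ?A w ?D"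
  proof unfold_locales
    show "?D (p \<otimes>\<^bsub>?A\<^esub> q) = ?r p q" if p: "p \<in> carrier ?A" and q: "q \<in> carrier ?A" for p q
      using linear_map_comp[OF A.linear_map_mult_left lin] linl _ p
      by (rule A.mpoly_linear_eqI) (use q in \<open>auto simp: mq\<close>)
    show "?D \<one>\<^bsub>?A\<^esub> = \<zero>\<^bsub>?A\<^esub>"
      using mon[of "{#}"] t_mset[of "[]"] by (simp add: mpoly_one L_Nil)
  qed (use w linear_mapD[OF lin] in auto)
qed

end

section \<open>Initialisation in integro-differential algebras\<close>

context comm_diff_algebra
begin

lemma d_linear: "linear_map R M M d"
  by (rule linear_mapI) (simp_all add: d_closed d_add d_smult)

lemma d_minus: "x \<in> carrier M \<Longrightarrow> y \<in> carrier M \<Longrightarrow> d (x \<ominus>\<^bsub>M\<^esub> y) = d x \<ominus>\<^bsub>M\<^esub> d y"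
  by (rule linear_map_minus[OF d_linear]) unfold_locales

lemma d_zero: "d \<zero>\<^bsub>M\<^esub> = \<zero>\<^bsub>M\<^esub>"
  by (rule linear_map_zero[OF d_linear]) unfold_locales

end

context comm_integro_diff_algebra
begin

definition initial :: "'c \<Rightarrow> 'c" where
  "initial x = x \<ominus>\<^bsub>M\<^esub> P (D x)"

lemma P_linear: "linear_map R M M P"
  by (rule linear_mapI) (simp_all add: P_closed P_add P_smult)

lemma initial_linear: "linear_map R M M initial"
proof (rule linear_mapI)
  show "initial x \<in> carrier M" if "x \<in> carrier M" for x
    using that by (simp add: initial_def P_closed d_closed)
  show "initial (x \<oplus>\<^bsub>M\<^esub> y) = initial x \<oplus>\<^bsub>M\<^esub> initial y" if "x \<in> carrier M" "y \<in> carrier M" for x y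
  proof -
    have "P (D x) \<in> carrier M" "P (D y) \<in> carrier M" using that by (simp_all add: P_closed d_closed)
    then show ?thesis using that unfolding initial_def
      by (simp add: d_add P_add d_closed) algebra
  qed
  show "initial (c \<odot>\<^bsub>M\<^esub> x) = c \<odot>\<^bsub>M\<^esub> initial x" if "c \<in> carrier R" "x \<in> carrier M" for c x
    using that
    by (simp add: initial_def d_smult P_smult P_closed d_closed M.minus_eq smult_r_distr smult_r_minus)
qed

lemma d_initial: "x \<in> carrier M \<Longrightarrow> D (initial x) = \<zero>\<^bsub>M\<^esub>"
  by (simp add: initial_def d_minus P_closed d_closed D_P r_right_minus_eq)

lemma initial_P: "x \<in> carrier M \<Longrightarrow> initial (P x) = \<zero>\<^bsub>M\<^esub>"
  by (simp add: initial_def P_closed D_P M.minus_eq M.r_neg)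

lemma initial_idem: "x \<in> carrier M \<Longrightarrow> initial (initial x) = initial x"
  using linear_mapD(1)[OF initial_linear] linear_map_zero[OF P_linear algebra_axioms]
  by (simp add: initial_def[of "initial x"] d_initial M.minus_eq)

lemma initial_one: "initial \<one>\<^bsub>M\<^esub> = \<one>\<^bsub>M\<^esub>"
  using linear_map_zero[OF P_linear algebra_axioms] by (simp add: initial_def d_one M.minus_eq)

text \<open>Expanding \<open>(x - P(D x)) (y - P(D y))\<close> shows that the axiom on products of
  integrals is the multiplicativity of \<open>initial\<close> in disguise.\<close>

lemma initial_mult:
  assumes x: "x \<in> carrier M" and y: "y \<in> carrier M"
  shows "initial (x \<otimes>\<^bsub>M\<^esub> y) = initial x \<otimes>\<^bsub>M\<^esub> initial y"
proof -
  have c: "P (D x) \<in> carrier M" "P (D y) \<in> carrier M" "P (D (x \<otimes>\<^bsub>M\<^esub> y)) \<in> carrier M"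
    using assms by (simp_all add: P_closed d_closed)
  have "initial x \<otimes>\<^bsub>M\<^esub> initial y = x \<otimes>\<^bsub>M\<^esub> y \<ominus>\<^bsub>M\<^esub> (P (D x) \<otimes>\<^bsub>M\<^esub> y \<oplus>\<^bsub>M\<^esub> x \<otimes>\<^bsub>M\<^esub> P (D y))
      \<oplus>\<^bsub>M\<^esub> P (D x) \<otimes>\<^bsub>M\<^esub> P (D y)"
    using c assms unfolding initial_def by algebra
  also have "\<dots> = initial (x \<otimes>\<^bsub>M\<^esub> y)"
    unfolding P_D_mult[OF assms] initial_def using c assms by algebra
  finally show ?thesis ..
qed

lemma P_unique:
  assumes "y \<in> carrier M" "initial y = \<zero>\<^bsub>M\<^esub>"
  shows "P (D y) = y"
  using assms by (simp add: initial_def r_right_minus_eq P_closed d_closed)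

end

text \<open>\<open>f (pA x)\<close> has derivative \<open>f x\<close>, and by \<open>init\<close>
  its initial value is \<open>f 0 = 0\<close>, so \<open>P_unique\<close> identifies it with
  \<open>pB (f x)\<close>. The gain is that \<open>initial\<close> is an algebra endomorphism:
  compatibility with it can be checked on generators, whereas integration is not
  multiplicative.\<close>

lemma integro_diff_homI:
  assumes "comm_integro_diff_algebra k A w dA pA" "comm_integro_diff_algebra k B w dB pB"
    and f: "f \<in> diff_hom k A dA B dB"
    and init: "\<And>x. x \<in> carrier A \<Longrightarrow>
      f (comm_integro_diff_algebra.initial A dA pA x) = comm_integro_diff_algebra.initial B dB pB (f x)"
  shows "f \<in> integro_diff_hom k A dA pA B dB pB"
proof -
  interpret A: comm_integro_diff_algebra k A w dA pA by fact
  interpret B: comm_integro_diff_algebra k B w dB pB by fact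
  have fl: "linear_map k A B f" and fd: "\<And>x. x \<in> carrier A \<Longrightarrow> f (dA x) = dB (f x)"
    using f by (auto simp: diff_hom_def intro: algebra_hom_linear)
  have "f (pA x) = pB (f x)" if x: "x \<in> carrier A" for x
  proof -
    have c: "f (pA x) \<in> carrier B" using x linear_mapD(1)[OF fl] by (simp add: A.P_closed)
    have "B.initial (f (pA x)) = \<zero>\<^bsub>B\<^esub>"
      using x init[of "pA x"] B.linear_map_zero[OF fl A.algebra_axioms] by (simp add: A.P_closed A.initial_P)
    from B.P_unique[OF c this] show ?thesis using x fd[of "pA x"] by (simp add: A.D_P A.P_closed)
  qed
  then show ?thesis using f by (simp add: integro_diff_hom_def)
qed

text \<open>Subtracting \<open>e y\<close> from any preimage \<open>y\<close> of \<open>x\<close>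
  gives a preimage killed by \<open>e\<close>. It is unique: the difference of two such preimages
  lies in the kernel of \<open>d\<close>, so \<open>e\<close> fixes it, yet \<open>e\<close> also
  kills it. This preimage is \<open>P x\<close>. Linearity follows by comparing derivatives and
  values of \<open>e\<close>, and the product axiom from \<open>P (d x) = x - e x\<close>.\<close>

lemma (in comm_diff_algebra) integro_diff_algebra_of_initialisation:
  assumes e_linear: "linear_map R M M e"
    and e_mult: "\<And>x y. x \<in> carrier M \<Longrightarrow> y \<in> carrier M \<Longrightarrow> e (x \<otimes>\<^bsub>M\<^esub> y) = e x \<otimes>\<^bsub>M\<^esub> e y"
    and e_idem: "\<And>x. x \<in> carrier M \<Longrightarrow> e (e x) = e x"
    and d_e: "\<And>x. x \<in> carrier M \<Longrightarrow> d (e x) = \<zero>\<^bsub>M\<^esub>"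
    and ker_d: "\<And>x. x \<in> carrier M \<Longrightarrow> d x = \<zero>\<^bsub>M\<^esub> \<Longrightarrow> e x = x"
    and d_surj: "\<And>x. x \<in> carrier M \<Longrightarrow> \<exists>y\<in>carrier M. d y = x"
  obtains P where "comm_integro_diff_algebra R M w d P"
    and "\<And>x. x \<in> carrier M \<Longrightarrow> comm_integro_diff_algebra.initial M d P x = e x"
proof -
  note ec = linear_mapD(1)[OF e_linear]
  note e_minus = linear_map_minus[OF e_linear algebra_axioms]
  have uniq: "y = z"
    if "y \<in> carrier M" "z \<in> carrier M" "d y = d z" "e y = \<zero>\<^bsub>M\<^esub>" "e z = \<zero>\<^bsub>M\<^esub>" for y z
  proof -
    have "d (y \<ominus>\<^bsub>M\<^esub> z) = \<zero>\<^bsub>M\<^esub>" using that by (simp add: d_minus d_closed r_right_minus_eq)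
    then have "y \<ominus>\<^bsub>M\<^esub> z = e (y \<ominus>\<^bsub>M\<^esub> z)" using that ker_d by simp
    also have "\<dots> = \<zero>\<^bsub>M\<^esub>" using that by (simp add: e_minus r_right_minus_eq)
    finally show ?thesis using that by (simp add: r_right_minus_eq)
  qed
  have de: "d (y \<ominus>\<^bsub>M\<^esub> e y) = d y" "e (y \<ominus>\<^bsub>M\<^esub> e y) = \<zero>\<^bsub>M\<^esub>" if y: "y \<in> carrier M" for y
    using d_minus[OF y ec[OF y]] e_minus[OF y ec[OF y]] d_closed[OF y] ec[OF y]
    by (simp_all add: d_e[OF y] e_idem[OF y]) (simp_all add: M.minus_eq M.r_neg)
  have ex: "\<exists>y\<in>carrier M. d y = x \<and> e y = \<zero>\<^bsub>M\<^esub>" if x: "x \<in> carrier M" for x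
  proof -
    obtain y where y: "y \<in> carrier M" "d y = x" using d_surj x by blast
    then have "d (y \<ominus>\<^bsub>M\<^esub> e y) = x" "e (y \<ominus>\<^bsub>M\<^esub> e y) = \<zero>\<^bsub>M\<^esub>"
      using de[OF y(1)] x by simp_all
    then show ?thesis using y ec by blast
  qed
  define P where "P x = (SOME y. y \<in> carrier M \<and> d y = x \<and> e y = \<zero>\<^bsub>M\<^esub>)" for x
  have P: "P x \<in> carrier M" "d (P x) = x" "e (P x) = \<zero>\<^bsub>M\<^esub>" if "x \<in> carrier M" for x
    using someI_ex[OF ex[OF that, unfolded Bex_def]] by (simp_all add: P_def)
  have P_eqI: "P (d y) = y" if "y \<in> carrier M" "e y = \<zero>\<^bsub>M\<^esub>" for y
    by (rule uniq) (use that in \<open>simp_all add: P d_closed\<close>)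
  have Pd: "P (d x) = x \<ominus>\<^bsub>M\<^esub> e x" if "x \<in> carrier M" for x
  proof -
    have "d (x \<ominus>\<^bsub>M\<^esub> e x) = d x" "e (x \<ominus>\<^bsub>M\<^esub> e x) = \<zero>\<^bsub>M\<^esub>"
      using de[OF that] by simp_all
    then show ?thesis using P_eqI[of "x \<ominus>\<^bsub>M\<^esub> e x"] that ec by simp
  qed
  have ida: "comm_integro_diff_algebra R M w d P"
  proof unfold_locales
    fix x y assume x: "x \<in> carrier M" and y: "y \<in> carrier M"
    have "e (P x \<oplus>\<^bsub>M\<^esub> P y) = \<zero>\<^bsub>M\<^esub>" "d (P x \<oplus>\<^bsub>M\<^esub> P y) = x \<oplus>\<^bsub>M\<^esub> y"
      using x y by (simp_all add: linear_mapD(2)[OF e_linear] d_add P)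
    then show "P (x \<oplus>\<^bsub>M\<^esub> y) = P x \<oplus>\<^bsub>M\<^esub> P y" using P_eqI[of "P x \<oplus>\<^bsub>M\<^esub> P y"] x y by (simp add: P)
    have "x \<in> carrier M" "y \<in> carrier M" "e x \<in> carrier M" "e y \<in> carrier M" using x y ec by auto
    then show "P (d x) \<otimes>\<^bsub>M\<^esub> P (d y) = P (d x) \<otimes>\<^bsub>M\<^esub> y \<oplus>\<^bsub>M\<^esub> x \<otimes>\<^bsub>M\<^esub> P (d y) \<ominus>\<^bsub>M\<^esub> P (d (x \<otimes>\<^bsub>M\<^esub> y))"
      unfolding Pd[OF x] Pd[OF y] Pd[OF m_closed[OF x y]] e_mult[OF x y] by algebra
  next
    fix c x assume c: "c \<in> carrier R" and x: "x \<in> carrier M"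
    have "e (c \<odot>\<^bsub>M\<^esub> P x) = \<zero>\<^bsub>M\<^esub>" "d (c \<odot>\<^bsub>M\<^esub> P x) = c \<odot>\<^bsub>M\<^esub> x"
      using c x by (simp_all add: linear_mapD(3)[OF e_linear] d_smult P)
    then show "P (c \<odot>\<^bsub>M\<^esub> x) = c \<odot>\<^bsub>M\<^esub> P x" using P_eqI[of "c \<odot>\<^bsub>M\<^esub> P x"] c x by (simp add: P)
  qed (simp_all add: P)
  moreover have "comm_integro_diff_algebra.initial M d P x = e x" if x: "x \<in> carrier M" for x
  proof -
    have "e x \<in> carrier M" using x ec by simp
    then show ?thesis unfolding comm_integro_diff_algebra.initial_def[OF ida] Pd[OF x] using x by algebra
  qed
  ultimately show ?thesis by (rule that)
qed

section \<open>Transport of structure\<close>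

text \<open>Freeness is assumed only for test algebras over particular types; the model is carried
  into such a type along an injection.\<close>

definition transport_module :: "('b \<Rightarrow> 'r) \<Rightarrow> ('k, 'b) module \<Rightarrow> ('k, 'r) module" where
  "transport_module \<phi> M =
    \<lparr> carrier = \<phi> ` carrier M,
      monoid.mult = (\<lambda>x y. \<phi> (inv_into UNIV \<phi> x \<otimes>\<^bsub>M\<^esub> inv_into UNIV \<phi> y)),
      monoid.one = \<phi> \<one>\<^bsub>M\<^esub>,
      ring.zero = \<phi> \<zero>\<^bsub>M\<^esub>,
      add = (\<lambda>x y. \<phi> (inv_into UNIV \<phi> x \<oplus>\<^bsub>M\<^esub> inv_into UNIV \<phi> y)),
      module.smult = (\<lambda>c x. \<phi> (c \<odot>\<^bsub>M\<^esub> inv_into UNIV \<phi> x)) \<rparr>"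

lemma transport_integro_diff:
  fixes M :: "('k, 'b) module" and \<phi> :: "'b \<Rightarrow> 'r"
  assumes \<phi>: "inj \<phi>" and M: "comm_integro_diff_algebra k M w D P"
  defines "N \<equiv> transport_module \<phi> M"
    and "D' \<equiv> \<lambda>x. \<phi> (D (inv_into UNIV \<phi> x))" and "P' \<equiv> \<lambda>x. \<phi> (P (inv_into UNIV \<phi> x))"
  shows "comm_integro_diff_algebra k N w D' P'"
    and "f \<in> diff_hom k A dA M D \<Longrightarrow> (\<lambda>x. \<phi> (f x)) \<in> diff_hom k A dA N D'"
    and "g \<in> integro_diff_hom k A dA pA N D' P' \<Longrightarrow> (\<lambda>x. inv_into UNIV \<phi> (g x)) \<in> integro_diff_hom k A dA pA M D P"
proof -
  interpret M: comm_integro_diff_algebra k M w D P by fact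
  have [simp]: "inv_into UNIV \<phi> (\<phi> x) = x" for x using \<phi> by simp
  note [simp] = transport_module_def
  have N: "cring N"
  proof (rule cringI)
    show "abelian_group N"
    proof (rule abelian_groupI)
      fix x assume "x \<in> carrier N"
      then obtain y where y: "y \<in> carrier M" "x = \<phi> y" by (auto simp: N_def)
      then have "\<phi> (\<ominus>\<^bsub>M\<^esub> y) \<in> carrier N" "\<phi> (\<ominus>\<^bsub>M\<^esub> y) \<oplus>\<^bsub>N\<^esub> x = \<zero>\<^bsub>N\<^esub>"
        by (auto simp: N_def M.M.l_neg)
      then show "\<exists>y\<in>carrier N. y \<oplus>\<^bsub>N\<^esub> x = \<zero>\<^bsub>N\<^esub>" by blast
    qed (auto simp: N_def M.M.a_ac)
    show "Group.comm_monoid N"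
      by (rule comm_monoidI) (auto simp: N_def M.m_ac)
  qed (auto simp: N_def M.l_distr)
  have "algebra k N"
    by (rule algebraI[OF M.R_cring N])
      (auto simp: N_def M.smult_l_distr M.smult_r_distr M.smult_assoc1 M.smult_assoc2)
  then interpret N: algebra k N .
  have minus: "\<phi> x \<ominus>\<^bsub>N\<^esub> \<phi> y = \<phi> (x \<ominus>\<^bsub>M\<^esub> y)" if "x \<in> carrier M" "y \<in> carrier M" for x y
  proof -
    have "\<phi> (x \<ominus>\<^bsub>M\<^esub> y) \<oplus>\<^bsub>N\<^esub> \<phi> y = \<phi> x"
      using that by (simp add: N_def M.M.minus_eq M.M.a_assoc M.M.l_neg)
    moreover have "\<phi> (x \<ominus>\<^bsub>M\<^esub> y) \<in> carrier N" "\<phi> y \<in> carrier N" using that by (simp_all add: N_def)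
    ultimately show ?thesis
      by (metis N.M.minus_eq N.M.a_assoc N.M.r_neg N.M.r_zero N.M.a_inv_closed)
  qed
  show "comm_integro_diff_algebra k N w D' P'"
  proof unfold_locales
    fix x y assume "x \<in> carrier N" "y \<in> carrier N"
    then obtain a b where ab: "a \<in> carrier M" "b \<in> carrier M" "x = \<phi> a" "y = \<phi> b" by (auto simp: N_def)
    have c: "P (D a) \<in> carrier M" "P (D b) \<in> carrier M" "P (D (a \<otimes>\<^bsub>M\<^esub> b)) \<in> carrier M"
      using ab by (simp_all add: M.P_closed M.d_closed)
    have "P' (D' x) \<otimes>\<^bsub>N\<^esub> y \<oplus>\<^bsub>N\<^esub> x \<otimes>\<^bsub>N\<^esub> P' (D' y) =
        \<phi> (P (D a) \<otimes>\<^bsub>M\<^esub> b \<oplus>\<^bsub>M\<^esub> a \<otimes>\<^bsub>M\<^esub> P (D b))"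
      using ab by (simp add: N_def D'_def P'_def)
    moreover have "P' (D' (x \<otimes>\<^bsub>N\<^esub> y)) = \<phi> (P (D (a \<otimes>\<^bsub>M\<^esub> b)))"
      using ab by (simp add: N_def D'_def P'_def)
    moreover have "P' (D' x) \<otimes>\<^bsub>N\<^esub> P' (D' y) = \<phi> (P (D a) \<otimes>\<^bsub>M\<^esub> P (D b))"
      using ab by (simp add: N_def D'_def P'_def)
    ultimately show "P' (D' x) \<otimes>\<^bsub>N\<^esub> P' (D' y) =
        P' (D' x) \<otimes>\<^bsub>N\<^esub> y \<oplus>\<^bsub>N\<^esub> x \<otimes>\<^bsub>N\<^esub> P' (D' y) \<ominus>\<^bsub>N\<^esub> P' (D' (x \<otimes>\<^bsub>N\<^esub> y))"
      using minus ab c M.P_D_mult[OF ab(1,2)] by simp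
  qed (auto simp: N_def D'_def P'_def M.weight_closed M.d_closed M.d_add M.d_smult M.d_mult M.d_one
      M.P_closed M.P_add M.P_smult M.D_P)
  show "(\<lambda>x. \<phi> (f x)) \<in> diff_hom k A dA N D'" if "f \<in> diff_hom k A dA M D"
    using that by (auto simp: diff_hom_def algebra_hom_def ring_hom_def N_def D'_def Pi_def)
  show "(\<lambda>x. inv_into UNIV \<phi> (g x)) \<in> integro_diff_hom k A dA pA M D P"
    if "g \<in> integro_diff_hom k A dA pA N D' P'"
  proof -
    define h where "h x = inv_into UNIV \<phi> (g x)" for x
    have g_hom: "g \<in> algebra_hom k A N" and gd: "\<And>x. x \<in> carrier A \<Longrightarrow> g (dA x) = D' (g x)"
      and gp: "\<And>x. x \<in> carrier A \<Longrightarrow> g (pA x) = P' (g x)"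
      using that by (auto simp: integro_diff_hom_def diff_hom_def)
    note gH = algebra_homD[OF g_hom]
    have hc: "h x \<in> carrier M" if "x \<in> carrier A" for x
      using gH(1)[OF that] by (auto simp: h_def N_def)
    have "h (dA x) = D (h x)" "h (pA x) = P (h x)" if "x \<in> carrier A" for x
      using gd[OF that] gp[OF that] by (simp_all add: h_def D'_def P'_def)
    moreover have "h \<in> algebra_hom k A M"
    proof (rule algebra_homI)
      show "linear_map k A M h"
        using hc gH(2,4) by (intro linear_mapI) (simp_all add: h_def N_def)
      show "h (x \<otimes>\<^bsub>A\<^esub> y) = h x \<otimes>\<^bsub>M\<^esub> h y" if "x \<in> carrier A" "y \<in> carrier A" for x y
        using gH(3)[OF that] by (simp add: h_def N_def)
      show "h \<one>\<^bsub>A\<^esub> = \<one>\<^bsub>M\<^esub>" using gH(5) by (simp add: h_def N_def)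
    qed
    ultimately have "h \<in> integro_diff_hom k A dA pA M D P"
      by (simp add: integro_diff_hom_def diff_hom_def)
    then show ?thesis by (simp add: h_def[abs_def])
  qed
qed

section \<open>Variables and leading monomials\<close>

text \<open>\<open>Der i\<close> is \<open>u\<^sub>i\<close>, \<open>Init i\<close> is its initial value \<open>e(u\<^sub>i)\<close>, and \<open>Integ s\<close> is the integral of the monomial \<open>s\<close>.
  The monomial \<open>dmon v\<close> is the derivative of \<open>v\<close>, and is a junk value for the constants \<open>Init i\<close>.\<close>

datatype idvar = Init nat | Der nat | Integ "idvar multiset"

primrec moving :: "idvar \<Rightarrow> bool" where
  "moving (Init i) = False"
| "moving (Der i) = True"
| "moving (Integ s) = True"

primrec dmon :: "idvar \<Rightarrow> idvar multiset" where
  "dmon (Init i) = {#}"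
| "dmon (Der i) = {#Der (Suc i)#}"
| "dmon (Integ s) = s"

text \<open>The inner \<open>Suc\<close> counts letters of weight 0 as well, which makes the weight
  of \<open>Integ s\<close> strictly monotone in \<open>s\<close>; the outer one lifts even
  \<open>Integ {#}\<close> above every \<open>Der i\<close>.\<close>

primrec wt :: "idvar \<Rightarrow> nat" where
  "wt (Init i) = 0"
| "wt (Der i) = 0"
| "wt (Integ s) = Suc (sum_mset (image_mset Suc (image_mset wt s)))"

text \<open>By weight: an integral of weight at most \<open>n\<close> is given by a word in
  variables of weight below \<open>n\<close>, so each level is countable. Countability supplies the
  tie-break in \<open>rank\<close> and later the embedding of the model into functions on
  \<open>nat\<close>.\<close>

lemma ex_inj_idvar: "\<exists>f :: idvar \<Rightarrow> nat. inj f"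
proof -
  define L where "L n = {x. wt x < n}" for n
  have "countable (L n)" for n
  proof (induction n)
    case 0
    then show ?case by (simp add: L_def)
  next
    case (Suc n)
    have "L (Suc n) \<subseteq> range Init \<union> range Der \<union> (Integ \<circ> mset) ` lists (L n)"
    proof
      fix x assume x: "x \<in> L (Suc n)"
      show "x \<in> range Init \<union> range Der \<union> (Integ \<circ> mset) ` lists (L n)"
      proof (cases x)
        case (Integ s)
        obtain xs where xs: "mset xs = s" using ex_mset by blast
        have "\<forall>y\<in>set xs. y \<in> L n"
        proof
          fix y assume "y \<in> set xs"
          then obtain s' where "s = add_mset y s'" using xs by (metis in_multiset_in_set insert_DiffM)
          then show "y \<in> L n" using x Integ by (simp add: L_def)
        qed
        then show ?thesis using xs Integ by (auto simp: in_lists_conv_set)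
      qed auto
    qed
    moreover have "countable (range Init \<union> range Der \<union> (Integ \<circ> mset) ` lists (L n))"
      using Suc by (intro countable_Un countable_image countable_lists) auto
    ultimately show ?case by (rule countable_subset)
  qed
  then have "countable (\<Union>n. L n)" by auto
  also have "(\<Union>n. L n) = UNIV" by (auto simp: L_def)
  finally show ?thesis by (simp add: countable_def)
qed

instance idvar :: countable
  by (rule countable_classI[of "SOME f. inj f"])
    (use someI_ex[OF ex_inj_idvar] in \<open>auto dest: injD\<close>)

lemma wt_mem: "x \<in># s \<Longrightarrow> wt x < wt (Integ s)"
  by (induction s) auto

lemma wt_subset: "s \<subset># t \<Longrightarrow> wt (Integ s) < wt (Integ t)"
proof -
  assume st: "s \<subset># t"
  then obtain r where r: "t = s + r" "r \<noteq> {#}"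
    by (metis subset_mset.le_iff_add subset_mset.less_imp_le subset_mset.less_irrefl add.right_neutral)
  then obtain y r' where "r = add_mset y r'" by (metis multiset_cases)
  with r show ?thesis by simp
qed

text \<open>All that matters about the order is that the derivatives of a variable only involve smaller
  variables, that every \<open>Der i\<close> is below every \<open>Integ s\<close>, that \<open>Integ\<close> is monotone, and that the order
  is well-founded as long as the indices of the \<open>Der i\<close> are bounded.\<close>

primrec rank :: "idvar \<Rightarrow> nat \<times> int" where
  "rank (Init i) = (0, 0)"
| "rank (Der i) = (0, - int i)"
| "rank (Integ s) = (wt (Integ s), int (to_nat (Integ s)))"

definition prec :: "idvar \<Rightarrow> idvar \<Rightarrow> bool" (infix \<open>\<lless>\<close> 50) where
  "x \<lless> y \<longleftrightarrow> fst (rank x) < fst (rank y) \<or> fst (rank x) = fst (rank y) \<and> snd (rank x) < snd (rank y)"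

lemma prec_irrefl [simp]: "\<not> x \<lless> x" by (simp add: prec_def)
lemma prec_trans [trans]: "x \<lless> y \<Longrightarrow> y \<lless> z \<Longrightarrow> x \<lless> z" by (auto simp: prec_def)
lemma prec_asym: "x \<lless> y \<Longrightarrow> \<not> y \<lless> x" by (auto simp: prec_def)
lemma not_prec_trans: "\<not> x \<lless> y \<Longrightarrow> \<not> y \<lless> z \<Longrightarrow> \<not> x \<lless> z" by (auto simp: prec_def)
text \<open>All \<open>Init i\<close> share the rank of \<open>Der 0\<close>, so totality is limited
  to moving variables. Among integrals of equal weight the injective \<open>to_nat\<close>
  decides.\<close>

lemma prec_total:
  assumes "moving x" "moving y" "\<not> x \<lless> y" "\<not> y \<lless> x" shows "x = y"
  using assms by (cases x; cases y) (auto simp: prec_def)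

lemma fst_rank: "fst (rank x) = wt x" by (cases x) auto

lemma dmon_prec:
  assumes "moving v" "x \<in># dmon v" shows "x \<lless> v"
  using assms by (cases v) (auto simp: prec_def fst_rank dest: wt_mem)

lemma Der_prec_Integ: "Der i \<lless> Integ s" by (simp add: prec_def)

lemma Integ_prec_mono: "s \<subset># t \<Longrightarrow> Integ s \<lless> Integ t"
  using wt_subset by (auto simp: prec_def)

text \<open>Further occurrences of \<open>v\<close> in \<open>q\<close> are permitted, since
  \<open>v\<close> may have a higher exponent. Constants are skipped because their derivative
  vanishes.\<close>

definition precedes_all :: "idvar \<Rightarrow> idvar multiset \<Rightarrow> bool" where
  "precedes_all v q \<longleftrightarrow> (\<forall>x\<in>#q. moving x \<longrightarrow> \<not> x \<lless> v)"

text \<open>Says that \<open>p\<close> is the leading monomial of the derivative of \<open>m = p - dmon v + {#v#}\<close>, where \<open>v\<close> is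
  the least nonconstant variable of \<open>m\<close>.\<close>

definition is_lead :: "idvar \<Rightarrow> idvar multiset \<Rightarrow> bool" where
  "is_lead v p \<longleftrightarrow> moving v \<and> dmon v \<subseteq># p \<and> precedes_all v (p - dmon v)"

text \<open>In any case \<open>s\<close> is the leading monomial of the derivative of \<open>Integ s\<close>; this integral is adjoined only if \<open>s\<close> is
  not a leading monomial otherwise.\<close>

inductive_set good :: "idvar set" where
  Init: "Init i \<in> good"
| Der: "Der i \<in> good"
| Integ: "\<lbrakk>\<And>x. x \<in># s \<Longrightarrow> x \<in> good; \<And>x. x \<in># s \<Longrightarrow> moving x;
    \<And>v. is_lead v s \<Longrightarrow> v = Integ s\<rbrakk> \<Longrightarrow> Integ s \<in> good"

lemma good_IntegD:
  assumes "Integ s \<in> good"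
  shows "x \<in># s \<Longrightarrow> x \<in> good" "x \<in># s \<Longrightarrow> moving x" "is_lead v s \<Longrightarrow> v = Integ s"
  using assms by (cases; auto)+

lemma dmon_good: "v \<in> good \<Longrightarrow> set_mset (dmon v) \<subseteq> good"
  by (cases v) (auto dest: good_IntegD intro: good.Der)

lemma dmon_moving: "v \<in> good \<Longrightarrow> x \<in># dmon v \<Longrightarrow> moving x"
  by (cases v) (auto dest: good_IntegD)

text \<open>The letters of \<open>dmon v\<close> lie below \<open>v\<close>, hence below
  \<open>v'\<close>, so none of them is left in \<open>p - dmon v'\<close>; all their copies in
  \<open>p\<close> belong to \<open>dmon v'\<close>, and thus \<open>dmon v\<close> is contained in
  \<open>dmon v'\<close>. If \<open>v' = Integ s'\<close>, then \<open>v\<close> already leads to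
  \<open>s'\<close>, against \<open>good\<close>; if \<open>v' = Der j\<close>, the containment
  forces \<open>v = v'\<close>.\<close>

lemma is_lead_unique_aux:
  assumes "v \<in> good" "v' \<in> good" "is_lead v p" "is_lead v' p" "v \<lless> v'"
  shows False
proof -
  note L = assms(3,4)[unfolded is_lead_def precedes_all_def]
  have c0: "count (p - dmon v') x = 0" if "moving x" "x \<lless> v'" for x
    unfolding count_eq_zero_iff using that L(2) by blast
  have below: "count (dmon v) x \<le> count (dmon v') x" for x
  proof (cases "x \<in># dmon v")
    case True
    then have "moving x" "x \<lless> v'" using dmon_moving dmon_prec prec_trans assms L by blast+
    then have "count p x \<le> count (dmon v') x" using c0[of x] by simp
    moreover have "count (dmon v) x \<le> count p x" using L(1) by (simp add: mset_subset_eq_count)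
    ultimately show ?thesis by simp
  qed (simp add: not_in_iff)
  then have sub: "dmon v \<subseteq># dmon v'" by (simp add: subseteq_mset_def)
  show False
  proof (cases v')
    case (Integ s')
    have "precedes_all v (s' - dmon v)" unfolding precedes_all_def
    proof (intro ballI impI)
      fix x assume x: "x \<in># s' - dmon v" "moving x"
      have "s' \<subseteq># p" using L(2) Integ by simp
      then have "s' - dmon v \<subseteq># p - dmon v" by (simp add: subseteq_mset_def diff_le_mono)
      then have "x \<in># p - dmon v" using x(1) by (rule mset_subset_eqD)
      then show "\<not> x \<lless> v" using L(1) x(2) by blast
    qed
    then have "is_lead v s'" using L(1) sub Integ by (simp add: is_lead_def)
    then have "v = v'" using good_IntegD(3) assms(2) Integ by blast
    then show False using assms(5) by simp
  next
    case (Der j)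
    show False
    proof (cases v)
      case (Der i) with \<open>v' = Der j\<close> sub assms(5) show False by simp
    next
      case (Integ s)
      with assms(5) Der_prec_Integ \<open>v' = Der j\<close> show False using prec_asym by blast
    qed (use L in auto)
  qed (use L in auto)
qed

lemma is_lead_unique:
  assumes "v \<in> good" "v' \<in> good" "is_lead v p" "is_lead v' p"
  shows "v = v'"
  using is_lead_unique_aux assms prec_total unfolding is_lead_def by metis

text \<open>Among all candidates, adjoined or not, one of least weight is adjoined: if it is
  \<open>Integ s\<close> and \<open>s\<close> were leading for another \<open>v'\<close>, then
  \<open>v'\<close> would be a candidate for the whole monomial too, of smaller weight.\<close>

lemma is_lead_exists:
  assumes "set_mset p \<subseteq> good"
  obtains v where "v \<in> good" "is_lead v p"
proof -
  \<comment> \<open>Integrals are adjoined only for monomials without constants, so the constants of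
    \<open>p\<close> are split off and put back at the end.\<close>
  define p0 where "p0 = filter_mset moving p"
  have p0: "set_mset p0 \<subseteq> good" "\<And>x. x \<in># p0 \<Longrightarrow> moving x" "p0 \<subseteq># p"
    using assms by (auto simp: p0_def)
  \<comment> \<open>There is always a candidate: for \<open>Integ p0\<close> the remaining factor is
    empty.\<close>
  have "is_lead (Integ p0) p0" by (simp add: is_lead_def precedes_all_def)
  then obtain v where v: "is_lead v p0" and min: "\<And>v'. is_lead v' p0 \<Longrightarrow> wt v \<le> wt v'"
    using arg_min_nat_lemma[of "\<lambda>v. is_lead v p0" _ wt] by blast
  note L = v[unfolded is_lead_def precedes_all_def]
  have "v \<in> good"
  proof (cases v)
    case (Integ s)
    show ?thesis unfolding Integ
    proof (rule good.Integ)
      have s: "s \<subseteq># p0" using L Integ by simp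
      then show "x \<in> good" "moving x" if "x \<in># s" for x
        using p0 that by (auto dest: mset_subset_eqD)
      fix v' assume v': "is_lead v' s"
      show "v' = Integ s"
      proof (rule ccontr)
        assume ne: "v' \<noteq> Integ s"
        have sub: "dmon v' \<subseteq># s" using v' by (simp add: is_lead_def)
        have pv: "\<not> Integ s \<lless> v'"
        proof (cases v')
          case (Integ s')
          with sub ne have "s' \<subset># s" by auto
          then show ?thesis using Integ_prec_mono Integ prec_asym by blast
        next
          case (Der j) then show ?thesis using Der_prec_Integ prec_asym by blast
        qed (use v' in \<open>simp add: is_lead_def\<close>)
        have "precedes_all v' (p0 - dmon v')"
          unfolding precedes_all_def
        proof (intro ballI impI)
          fix x assume x: "x \<in># p0 - dmon v'" "moving x"
          have "p0 - dmon v' = (p0 - s) + (s - dmon v')" using s sub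
            by (metis subset_mset.add_diff_assoc subset_mset.diff_add union_commute)
          then consider "x \<in># p0 - s" | "x \<in># s - dmon v'" using x by auto
          then show "\<not> x \<lless> v'"
          proof cases
            case 1 then have "\<not> x \<lless> Integ s" using L Integ x by simp
            then show ?thesis using not_prec_trans pv by blast
          next
            case 2 then show ?thesis using v' x by (simp add: is_lead_def precedes_all_def)
          qed
        qed
        then have "is_lead v' p0" using v' s by (auto simp: is_lead_def)
        then have "wt (Integ s) \<le> wt v'" using min Integ by fastforce
        moreover have "wt v' < wt (Integ s)"
        proof (cases v')
          case (Integ s')
          with sub ne have "s' \<subset># s" by auto
          then show ?thesis using wt_subset Integ by blast
        qed auto
        ultimately show False by simp
      qed
    qed
  next
    case (Der i) then show ?thesis by (simp add: good.Der)
  qed (use L in auto)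
  moreover have "is_lead v p"
  proof -
    have "precedes_all v (p - dmon v)" unfolding precedes_all_def
    proof (intro ballI impI)
      fix x assume x: "x \<in># p - dmon v" "moving x"
      have "count (p0 - dmon v) x = count (p - dmon v) x" using x(2) by (simp add: p0_def)
      then have "x \<in># p0 - dmon v" using x(1) by (metis count_eq_zero_iff)
      then show "\<not> x \<lless> v" using L x by simp
    qed
    then show ?thesis using v p0(3) by (auto simp: is_lead_def)
  qed
  ultimately show ?thesis using that by blast
qed

section \<open>Triangularity of the derivation\<close>

text \<open>A monomial drops in the multiset extension when a letter is exchanged for any number of
  smaller ones, which is what differentiating a letter does; moreover this order is compatible with
  products.\<close>

definition mless :: "(idvar multiset \<times> idvar multiset) set" where
  "mless = mult {(x, y). x \<lless> y}"

lemma trans_prec: "trans {(x, y). x \<lless> y}"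
  by (auto intro: transI prec_trans)

lemma irrefl_prec: "irrefl {(x, y). x \<lless> y}"
  by (auto intro: irreflI)

lemma mless_trans: "(a, b) \<in> mless \<Longrightarrow> (b, c) \<in> mless \<Longrightarrow> (a, c) \<in> mless"
  unfolding mless_def by (rule transD[OF trans_mult[OF trans_prec]])

lemma mless_irrefl: "(a, a) \<notin> mless"
  unfolding mless_def using irrefl_mult[OF trans_prec irrefl_prec] by (auto simp: irrefl_def)

lemma mless_asym: "(a, b) \<in> mless \<Longrightarrow> (b, a) \<notin> mless"
  using mless_trans mless_irrefl by blast

lemma mless_add_right: "(a, b) \<in> mless \<Longrightarrow> (a + c, b + c) \<in> mless"
  unfolding mless_def
  by (subst mult_cancel[OF trans_prec]) (use irrefl_prec in \<open>auto simp: irrefl_on_def\<close>)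

lemma mless_add_left: "(a, b) \<in> mless \<Longrightarrow> (c + a, c + b) \<in> mless"
  using mless_add_right[of a b c] by (simp add: add.commute)

lemma mless_replace: "(\<And>x. x \<in># b \<Longrightarrow> x \<lless> y) \<Longrightarrow> (a + b, add_mset y a) \<in> mless"
  unfolding mless_def using one_step_implies_mult[of "{#y#}" b "{(x, y). x \<lless> y}" a] by simp

text \<open>The order descends infinitely along \<open>Der 0, Der 1, \<dots>\<close>, but the reduction of a monomial to
  smaller ones does not raise the largest index of a \<open>Der i\<close> occurring in it hereditarily.\<close>

inductive_set bounded_vars :: "nat \<Rightarrow> idvar set" for H where
  Init: "Init i \<in> bounded_vars H"
| Der: "i \<le> H \<Longrightarrow> Der i \<in> bounded_vars H"
| Integ: "(\<And>x. x \<in># s \<Longrightarrow> x \<in> bounded_vars H) \<Longrightarrow> Integ s \<in> bounded_vars H"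

lemma bounded_vars_IntegD: "Integ s \<in> bounded_vars H \<Longrightarrow> x \<in># s \<Longrightarrow> x \<in> bounded_vars H"
  by (erule bounded_vars.cases) auto

lemma bounded_vars_DerD: "Der i \<in> bounded_vars H \<Longrightarrow> i \<le> H"
  by (erule bounded_vars.cases) auto

lemma bounded_vars_mono: "x \<in> bounded_vars H \<Longrightarrow> H \<le> H' \<Longrightarrow> x \<in> bounded_vars H'"
  by (induction rule: bounded_vars.induct) (auto intro: bounded_vars.intros)

lemma bounded_vars_mset:
  assumes "\<And>x. x \<in># m \<Longrightarrow> \<exists>H. x \<in> bounded_vars H"
  shows "\<exists>H. set_mset m \<subseteq> bounded_vars H"
  using assms
proof (induction m)
  case empty
  then show ?case by simp
next
  case (add x m)
  then obtain H H' where "x \<in> bounded_vars H" "set_mset m \<subseteq> bounded_vars H'" by force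
  then have "set_mset (add_mset x m) \<subseteq> bounded_vars (max H H')"
    by (auto intro: bounded_vars_mono)
  then show ?case by blast
qed

lemma bounded_vars_ex: "\<exists>H. x \<in> bounded_vars H"
proof (induction x)
  case (Init i)
  then show ?case by (auto intro: bounded_vars.Init)
next
  case (Der i)
  then show ?case by (auto intro: bounded_vars.Der)
next
  case (Integ s)
  then obtain H where "set_mset s \<subseteq> bounded_vars H" using bounded_vars_mset by blast
  then show ?case by (auto intro!: bounded_vars.Integ)
qed

text \<open>Adding \<open>H\<close> makes the second component of the rank of a bounded variable
  nonnegative, so \<open>nat\<close> preserves strict comparisons. Bounding the smaller variable
  suffices, as at equal weight the larger one then has a positive shifted component.\<close>

lemma wf_bounded_prec: "wf {(x, y). x \<lless> y \<and> x \<in> bounded_vars H}"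
proof (rule wf_subset)
  let ?\<mu> = "\<lambda>x. (fst (rank x), nat (snd (rank x) + int H))"
  show "wf (inv_image (less_than <*lex*> less_than) ?\<mu>)"
    by (intro wf_inv_image wf_lex_prod wf_less_than)
  show "{(x, y). x \<lless> y \<and> x \<in> bounded_vars H} \<subseteq> inv_image (less_than <*lex*> less_than) ?\<mu>"
  proof clarify
    fix x y assume xy: "x \<lless> y" and x: "x \<in> bounded_vars H"
    have "0 \<le> snd (rank x) + int H"
      using x by (cases x) (auto dest: bounded_vars_DerD)
    then show "(x, y) \<in> inv_image (less_than <*lex*> less_than) ?\<mu>"
      using xy by (auto simp: prec_def)
  qed
qed

text \<open>In a step from \<open>q\<close> down to \<open>p\<close> the new letters all occur in
  \<open>p\<close>, so a bound on \<open>p\<close> is enough.\<close>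

lemma mless_bounded:
  assumes "(p, q) \<in> mless" "set_mset p \<subseteq> bounded_vars H"
  shows "(p, q) \<in> mult {(x, y). x \<lless> y \<and> x \<in> bounded_vars H}"
proof -
  obtain I J K where IJK: "q = I + J" "p = I + K" "J \<noteq> {#}" "\<forall>k\<in>#K. \<exists>j\<in>#J. (k, j) \<in> {(x, y). x \<lless> y}"
    using mult_implies_one_step[OF trans_prec assms(1)[unfolded mless_def]] by blast
  have "\<forall>k\<in>#K. \<exists>j\<in>#J. (k, j) \<in> {(x, y). x \<lless> y \<and> x \<in> bounded_vars H}"
    using IJK(2,4) assms(2) by fastforce
  then show ?thesis unfolding IJK(1,2) using IJK(3) by (intro one_step_implies_mult)
qed

lemma ex_first_moving:
  assumes "x \<in># m" "moving x"
  obtains v where "v \<in># m" "moving v" "precedes_all v m"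
proof -
  let ?A = "{v \<in> set_mset m. moving v}"
  have "\<exists>v\<in>?A. \<forall>x\<in>?A. x \<noteq> v \<longrightarrow> \<not> x \<lless> v"
    using assms
    by (intro Finite_Set.bex_min_element)
      (auto simp: asymp_on_def transp_on_def dest: prec_asym prec_trans)
  then obtain v where v: "v \<in># m" "moving v" and "\<forall>x\<in>?A. x \<noteq> v \<longrightarrow> \<not> x \<lless> v" by blast
  then have "precedes_all v m"
    unfolding precedes_all_def by (metis (mono_tags, lifting) mem_Collect_eq prec_irrefl)
  with v show ?thesis by (rule that)
qed

text \<open>The critical case is \<open>Der i\<close> in the remaining factor, whose derivative has
  index \<open>i + 1\<close>. As \<open>Der i\<close> is not below \<open>v\<close>, necessarily
  \<open>v = Der j\<close> with \<open>i \<le> j\<close>, and \<open>Der (j + 1)\<close> already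
  occurs in \<open>p\<close>.\<close>

lemma bounded_lead:
  assumes v: "is_lead v p" and p: "set_mset p \<subseteq> bounded_vars H"
    and x: "x \<in># add_mset v (p - dmon v)
      \<or> (\<exists>y. y \<in># add_mset v (p - dmon v) \<and> moving y \<and> x \<in># dmon y)"
  shows "x \<in> bounded_vars H"
proof -
  note L = v[unfolded is_lead_def precedes_all_def]
  have dv: "set_mset (dmon v) \<subseteq> bounded_vars H" using L p set_mset_mono by blast
  have vb: "v \<in> bounded_vars H"
  proof (cases v)
    case (Der i)
    then show ?thesis using dv by (auto dest!: bounded_vars_DerD intro: bounded_vars.Der)
  next
    case (Integ s)
    then show ?thesis using dv by (auto intro!: bounded_vars.Integ)
  qed (use L in simp)
  have rest: "y \<in> bounded_vars H" if "y \<in># p - dmon v" for y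
    using that p by (auto dest: in_diffD)
  have "x \<in> bounded_vars H" if y: "y \<in># p - dmon v" "moving y" "x \<in># dmon y" for y
  proof (cases y)
    case (Der i)
    then have "\<not> Der i \<lless> v" using L y by blast
    then obtain j where j: "v = Der j" "i \<le> j"
      using L Der_prec_Integ by (cases v) (auto simp: prec_def)
    then have "Suc j \<le> H" using dv by (auto dest: bounded_vars_DerD)
    then show ?thesis using y Der j by (auto intro: bounded_vars.Der)
  next
    case (Integ s)
    then show ?thesis using rest[OF y(1)] y(3) bounded_vars_IntegD by simp
  qed (use y in simp)
  then show ?thesis using x vb dv rest by auto
qed

section \<open>The derivation of the model and its leading terms\<close>

locale idmodel = cring R for R (structure) +
  fixes w
  assumes w_closed: "w \<in> carrier R"
    and Units_of_nat: "0 < (n::nat) \<Longrightarrow> add_pow R n \<one> \<in> Units R"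
begin

abbreviation M where "M \<equiv> mpoly R good"

definition \<delta> :: "idvar \<Rightarrow> idvar multiset \<Rightarrow> 'a" where
  "\<delta> x = (if moving x then mmon R (dmon x) else \<zero>\<^bsub>M\<^esub>)"

definition D :: "(idvar multiset \<Rightarrow> 'a) \<Rightarrow> idvar multiset \<Rightarrow> 'a" where
  "D = mderiv R good w \<delta>"

sublocale M: algebra R M by (rule algebra_mpoly)

lemma \<delta>_closed: "x \<in> good \<Longrightarrow> \<delta> x \<in> carrier M"
  using dmon_good by (auto simp: \<delta>_def mmon_closed)

sublocale D: comm_diff_algebra R M w D
  unfolding D_def by (rule mderiv_diff[OF w_closed \<delta>_closed])

lemma D_var: "x \<in> good \<Longrightarrow> D (mmon R {#x#}) = \<delta> x"
  unfolding D_def by (rule mderiv_var[OF w_closed \<delta>_closed])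

lemma D_coeff_closed [simp]: "x \<in> carrier M \<Longrightarrow> D x q \<in> carrier R"
  using D.d_closed mpoly_carrierD(1) by blast

lemma D_moving_coeff:
  assumes "v \<in> good" "set_mset m \<subseteq> good" "moving v"
  shows "D (mmon R (add_mset v m)) q = (if q = dmon v + m then \<one> else \<zero>) \<oplus>
    (if v \<in># q then D (mmon R m) (q - {#v#}) else \<zero>) \<oplus>
    w \<otimes> (if dmon v \<subseteq># q then D (mmon R m) (q - dmon v) else \<zero>)"
proof -
  have c: "mmon R {#v#} \<in> carrier M" "mmon R m \<in> carrier M" "D (mmon R m) q \<in> carrier R" for q
    using assms by (auto simp: mmon_closed)
  have "D (mmon R (add_mset v m)) = D (mmon R {#v#} \<otimes>\<^bsub>M\<^esub> mmon R m)" by (simp add: mmon_mult)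
  also have "\<dots> = mmon R (dmon v + m) \<oplus>\<^bsub>M\<^esub> mmon R {#v#} \<otimes>\<^bsub>M\<^esub> D (mmon R m) \<oplus>\<^bsub>M\<^esub>
      w \<odot>\<^bsub>M\<^esub> (mmon R (dmon v) \<otimes>\<^bsub>M\<^esub> D (mmon R m))"
    using c assms by (simp add: D.d_mult D_var \<delta>_def) (simp add: mmon_mult)
  finally show ?thesis
    using c by (simp add: mpoly_coeff mmon_mult_coeff[OF c(3)]) (simp add: mmon_def)
qed

lemma D_moving_support:
  assumes "v \<in> good" "set_mset m \<subseteq> good" "moving v" and q: "D (mmon R (add_mset v m)) q \<noteq> \<zero>"
  shows "q = dmon v + m \<or> v \<in># q \<and> D (mmon R m) (q - {#v#}) \<noteq> \<zero>
    \<or> dmon v \<subseteq># q \<and> D (mmon R m) (q - dmon v) \<noteq> \<zero>"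
proof (rule ccontr)
  assume "\<not> ?thesis"
  then have "D (mmon R (add_mset v m)) q = \<zero> \<oplus> \<zero> \<oplus> w \<otimes> \<zero>"
    unfolding D_moving_coeff[OF assms(1-3)]
    by (intro arg_cong2[where f = "(\<oplus>)"] arg_cong2[where f = "(\<otimes>)"]) auto
  then show False using q w_closed by simp
qed

lemma D_Init_coeff:
  assumes "v \<in> good" "set_mset m \<subseteq> good" "\<not> moving v"
  shows "D (mmon R (add_mset v m)) q = (if v \<in># q then D (mmon R m) (q - {#v#}) else \<zero>)"
proof -
  have c: "mmon R {#v#} \<in> carrier M" "mmon R m \<in> carrier M" "D (mmon R m) q \<in> carrier R" for q
    using assms by (auto simp: mmon_closed)
  have "D (mmon R (add_mset v m)) = D (mmon R {#v#} \<otimes>\<^bsub>M\<^esub> mmon R m)" by (simp add: mmon_mult)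
  also have "\<dots> = mmon R {#v#} \<otimes>\<^bsub>M\<^esub> D (mmon R m)"
    using c assms w_closed by (simp add: D.d_mult D_var \<delta>_def D.d_closed)
  finally show ?thesis
    using c by (simp add: mmon_mult_coeff[OF c(3)])
qed

lemma D_one_mmon: "D (mmon R {#}) = \<zero>\<^bsub>M\<^esub>"
  using D.d_one by (simp add: mpoly_one)

lemma D_const:
  assumes "set_mset m \<subseteq> good" "\<And>x. x \<in># m \<Longrightarrow> \<not> moving x"
  shows "D (mmon R m) q = \<zero>"
  using assms
proof (induction m arbitrary: q)
  case empty
  then show ?case by (simp add: D_one_mmon mpoly_coeff)
next
  case (add x m)
  then show ?case by (simp add: D_Init_coeff)
qed

text \<open>Together with \<open>bounded_lead\<close> this keeps the index bound during the
  reduction in \<open>D_surj\<close>.\<close>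

lemma D_support:
  assumes "set_mset m \<subseteq> good" "D (mmon R m) q \<noteq> \<zero>" "x \<in># q"
  shows "x \<in># m \<or> (\<exists>y. y \<in># m \<and> moving y \<and> x \<in># dmon y)"
  using assms
proof (induction m arbitrary: q x)
  case empty
  then show ?case by (simp add: D_one_mmon mpoly_coeff)
next
  case (add v m)
  have IH: "y \<in># m \<or> (\<exists>z. z \<in># m \<and> moving z \<and> y \<in># dmon z)"
    if "D (mmon R m) q' \<noteq> \<zero>" "y \<in># q'" for q' y using add that by auto
  show ?case
  proof (cases "moving v")
    case True
    have "q = dmon v + m \<or> v \<in># q \<and> D (mmon R m) (q - {#v#}) \<noteq> \<zero>
      \<or> dmon v \<subseteq># q \<and> D (mmon R m) (q - dmon v) \<noteq> \<zero>"
      using D_moving_support[of v m q] add.prems True by simp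
    then consider "q = dmon v + m" | "v \<in># q" "D (mmon R m) (q - {#v#}) \<noteq> \<zero>"
      | "dmon v \<subseteq># q" "D (mmon R m) (q - dmon v) \<noteq> \<zero>" by blast
    then show ?thesis
    proof cases
      case 1
      then show ?thesis using add.prems True by auto
    next
      case 2
      show ?thesis
      proof (cases "x = v")
        case False
        then have "x \<in># q - {#v#}" using add.prems(3) by (simp add: in_diff_count)
        then show ?thesis using IH[OF 2(2)] by auto
      qed simp
    next
      case 3
      then have "x \<in># dmon v \<or> x \<in># q - dmon v" using add.prems(3)
        by (metis subset_mset.add_diff_inverse union_iff)
      then show ?thesis using IH[OF 3(2)] True by auto
    qed
  next
    case False
    then have 2: "v \<in># q" "D (mmon R m) (q - {#v#}) \<noteq> \<zero>"
      using add.prems D_Init_coeff[of v m q] by (auto split: if_splits)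
    show ?thesis
    proof (cases "x = v")
      case False
      then have "x \<in># q - {#v#}" using add.prems(3) by (simp add: in_diff_count)
      then show ?thesis using IH[OF 2(2)] by auto
    qed simp
  qed
qed

text \<open>\<open>D(v m) = dmon v * m + v * D m + w * dmon v * D m\<close>. The first term is the
  claimed leading one. By induction \<open>D m\<close> lies below \<open>m\<close>, so the weighted
  term is smaller. The middle term reaches the leading monomial only if \<open>v\<close> is again
  the least moving letter of \<open>m\<close>, and then raises the coefficient by that of
  \<open>D m\<close>; this accumulates to the exponent of \<open>v\<close>.\<close>

lemma D_triangular:
  assumes "v \<in> good" "moving v" "precedes_all v m" "set_mset m \<subseteq> good"
  shows "\<exists>c::nat. 0 < c \<and> D (mmon R (add_mset v m)) (m + dmon v) = add_pow R c \<one>"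
    and "D (mmon R (add_mset v m)) q \<noteq> \<zero> \<Longrightarrow> q = m + dmon v \<or> (q, m + dmon v) \<in> mless"
proof -
  have "(\<exists>c::nat. 0 < c \<and> D (mmon R (add_mset v m)) (m + dmon v) = add_pow R c \<one>) \<and>
    (\<forall>q. D (mmon R (add_mset v m)) q \<noteq> \<zero> \<longrightarrow> q = m + dmon v \<or> (q, m + dmon v) \<in> mless)"
    using assms
  proof (induction "size m" arbitrary: v m)
    case 0
    then have m: "m = {#}" by simp
    have "D (mmon R {#v#}) q = (if q = dmon v then \<one> else \<zero>)" for q
      using D_moving_coeff[of v "{#}" q] 0 w_closed by (simp add: D_one_mmon mpoly_coeff)
    then show ?case unfolding m by (auto intro!: exI[of _ "1::nat"])
  next
    case (Suc n)
    let ?l = "m + dmon v"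
    note co = D_moving_coeff[OF Suc.prems(1,4,2)]
    have c: "D (mmon R m) q \<in> carrier R" for q using Suc.prems by (auto simp: mmon_closed)
    show ?case
    proof (cases "\<exists>x\<in>#m. moving x")
      case False
      then have "D (mmon R m) q = \<zero>" for q using Suc.prems by (intro D_const) auto
      then have "D (mmon R (add_mset v m)) q = (if q = ?l then \<one> else \<zero>)" for q
        unfolding co using w_closed by (simp add: add.commute)
      then show ?thesis by (auto intro!: exI[of _ "1::nat"])
    next
      case True
      then obtain v' where v': "v' \<in># m" "moving v'" "precedes_all v' m"
        using ex_first_moving by blast
      then obtain m' where m: "m = add_mset v' m'" by (metis insert_DiffM)
      let ?l' = "m' + dmon v'"
      have "v' \<in> good" "precedes_all v' m'" "set_mset m' \<subseteq> good" "n = size m'"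
        using v' m Suc.prems Suc.hyps(2) by (auto simp: precedes_all_def)
      with Suc.hyps(1)[OF this(4) this(1) v'(2) this(2,3)]
      obtain c' where c': "0 < (c'::nat)" "D (mmon R m) ?l' = add_pow R c' \<one>"
        and low: "\<And>q. D (mmon R m) q \<noteq> \<zero> \<Longrightarrow> q = ?l' \<or> (q, ?l') \<in> mless"
        unfolding m by blast
      have l'm: "(?l', m) \<in> mless" unfolding m
        using dmon_prec[OF v'(2)] by (rule mless_replace)
      have below_m: "D (mmon R m) q \<noteq> \<zero> \<Longrightarrow> (q, m) \<in> mless" for q
        using low l'm mless_trans by blast
      have "\<not> v' \<lless> v" using Suc.prems(3) v' by (auto simp: precedes_all_def)
      then consider (eq) "v' = v" | (less) "v \<lless> v'" using prec_total v' Suc.prems(2) by blast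
      \<comment> \<open>For \<open>v\<close> below \<open>v'\<close>, passing from \<open>m\<close>
        to \<open>add_mset v ?l'\<close> replaces \<open>v'\<close> by \<open>v\<close> and
        \<open>dmon v'\<close>, all of them smaller, so the result is below \<open>m\<close> and
        hence below \<open>?l\<close>.\<close>
      then have l: "add_mset v ?l' = ?l \<and> v' = v \<or> (add_mset v ?l', ?l) \<in> mless"
      proof cases
        case eq
        then show ?thesis by (simp add: m add.commute)
      next
        case less
        have "(m' + add_mset v (dmon v'), m) \<in> mless" unfolding m
          by (rule mless_replace) (use less dmon_prec[OF v'(2)] in auto)
        moreover have "m = ?l \<or> (m, ?l) \<in> mless"
        proof (cases "dmon v = {#}")
          case False
          then show ?thesis unfolding mless_def
            using one_step_implies_mult[of "dmon v" "{#}" _ m] by simp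
        qed simp
        ultimately show ?thesis using mless_trans by auto
      qed
      have v_le: "add_mset v q = ?l \<and> v' = v \<and> q = ?l' \<or> (add_mset v q, ?l) \<in> mless"
        if "D (mmon R m) q \<noteq> \<zero>" for q
      proof (cases "q = ?l'")
        case False
        then have "(q, ?l') \<in> mless" using low that by blast
        then have "(add_mset v q, add_mset v ?l') \<in> mless" using mless_add_left[of q ?l' "{#v#}"] by simp
        then show ?thesis using l mless_trans by auto
      qed (use l in auto)
      \<comment> \<open>At the monomial \<open>?l\<close> the weighted term contributes
        \<open>w\<close> times the coefficient of \<open>m\<close> in \<open>D m\<close>.\<close>
      have third: "D (mmon R m) m = \<zero>" using below_m mless_irrefl by blast
      have "\<exists>c::nat. 0 < c \<and> D (mmon R (add_mset v m)) ?l = add_pow R c \<one>"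
      proof (cases "v \<in># ?l \<and> D (mmon R m) (?l - {#v#}) \<noteq> \<zero>")
        case True
        then have "?l - {#v#} = ?l'" using v_le[of "?l - {#v#}"] mless_irrefl by auto
        then have "D (mmon R (add_mset v m)) ?l = \<one> \<oplus> add_pow R c' \<one>"
          unfolding co using third c' True w_closed by (simp add: add.commute)
        then have "D (mmon R (add_mset v m)) ?l = add_pow R (Suc c') \<one>" by (simp add: a_comm)
        then show ?thesis by blast
      next
        case False
        then have "D (mmon R (add_mset v m)) ?l = \<one>"
          unfolding co using third w_closed by (auto simp: add.commute)
        then show ?thesis by (auto intro!: exI[of _ "1::nat"])
      qed
      moreover have "q = ?l \<or> (q, ?l) \<in> mless" if q: "D (mmon R (add_mset v m)) q \<noteq> \<zero>" for q
      proof -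
        have "q = ?l \<or> v \<in># q \<and> D (mmon R m) (q - {#v#}) \<noteq> \<zero>
          \<or> dmon v \<subseteq># q \<and> D (mmon R m) (q - dmon v) \<noteq> \<zero>"
          using D_moving_support[OF Suc.prems(1,4,2) q] by (simp add: add.commute)
        then consider "q = ?l" | "v \<in># q" "D (mmon R m) (q - {#v#}) \<noteq> \<zero>"
          | "dmon v \<subseteq># q" "D (mmon R m) (q - dmon v) \<noteq> \<zero>" by blast
        then show ?thesis
        proof cases
          case 2
          then show ?thesis using v_le[OF 2(2)] by auto
        next
          case 3
          then have "(q - dmon v + dmon v, ?l) \<in> mless" by (intro mless_add_right below_m)
          then show ?thesis using 3(1) by simp
        qed simp
      qed
      ultimately show ?thesis by blast
    qed
  qed
  then show "\<exists>c::nat. 0 < c \<and> D (mmon R (add_mset v m)) (m + dmon v) = add_pow R c \<one>"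
    and "D (mmon R (add_mset v m)) q \<noteq> \<zero> \<Longrightarrow> q = m + dmon v \<or> (q, m + dmon v) \<in> mless"
    by blast+
qed

end

section \<open>The integro-differential structure\<close>

lemma (in cring) mpoly_linear_coeff:
  assumes f: "linear_map R (mpoly R V) (mpoly R W) f" and p: "p \<in> carrier (mpoly R V)"
  shows "f p q = (\<Oplus>m\<in>{m. p m \<noteq> \<zero>}. p m \<otimes> f (mmon R m) q)"
proof -
  interpret W: algebra R "mpoly R W" by (rule algebra_mpoly)
  have fc: "f (mmon R m) \<in> carrier (mpoly R W)" if "set_mset m \<subseteq> V" for m
    using linear_mapD(1)[OF f mmon_closed[OF that]] .
  have "f p = W.mlin (\<lambda>m. f (mmon R m)) p"
    using f W.mlin_linear[of V "\<lambda>m. f (mmon R m)", OF fc] _ p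
  proof (rule W.mpoly_linear_eqI)
    show "f (mmon R m) = W.mlin (\<lambda>m. f (mmon R m)) (mmon R m)" if "set_mset m \<subseteq> V" for m
      using W.mlin_mmon[of "\<lambda>m. f (mmon R m)" m, OF fc[OF that]] ..
  qed
  then show ?thesis
    using mpoly_carrierD[OF p] fc
    by (simp add: W.mlin_def, subst mpoly_finsum_coeff[where V = W]) (auto simp: mpoly_coeff)
qed

context idmodel
begin

text \<open>Each monomial \<open>p\<close> is leading in some \<open>?Dm\<close>. The remainder
  after removing its leading term has smaller monomials with the same index bound, so it lies in the
  image by induction; hence so does a positive integer multiple of \<open>p\<close>, and that
  integer is a unit.\<close>

lemma D_surj:
  assumes x: "x \<in> carrier M"
  shows "\<exists>y\<in>carrier M. D y = x"
proof -
  let ?I = "D ` carrier M"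
  have I_add: "a \<oplus>\<^bsub>M\<^esub> b \<in> ?I" if "a \<in> ?I" "b \<in> ?I" for a b
    using that by (auto simp: D.d_add[symmetric])
  have I_smult: "c \<odot>\<^bsub>M\<^esub> a \<in> ?I" if "c \<in> carrier R" "a \<in> ?I" for c a
    using that by (auto simp: D.d_smult[symmetric])
  have I_zero: "\<zero>\<^bsub>M\<^esub> \<in> ?I" using D.d_zero by (metis M.M.zero_closed imageI)
  have mon: "set_mset p \<subseteq> good \<Longrightarrow> set_mset p \<subseteq> bounded_vars H \<Longrightarrow> mmon R p \<in> ?I" for p H
  proof (induction p rule: wf_induct_rule[OF wf_mult[OF wf_bounded_prec[of H]]])
    case (1 p)
    obtain v where v: "v \<in> good" "is_lead v p" using is_lead_exists 1(2) by blast
    define m where "m = p - dmon v"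
    have p: "p = m + dmon v" using v by (simp add: m_def is_lead_def)
    have m: "moving v" "precedes_all v m" "set_mset m \<subseteq> good"
      using v 1(2) by (auto simp: m_def is_lead_def dest: in_diffD)
    let ?Dm = "D (mmon R (add_mset v m))"
    have mc: "mmon R (add_mset v m) \<in> carrier M" using v m by (simp add: mmon_closed)
    then have Dmc: "?Dm \<in> carrier M" by (rule D.d_closed)
    obtain c where c: "0 < (c::nat)" "?Dm p = add_pow R c \<one>"
      and low: "\<And>q. ?Dm q \<noteq> \<zero> \<Longrightarrow> q = p \<or> (q, p) \<in> mless"
      using D_triangular[OF v(1) m] p by blast
    let ?c = "add_pow R c \<one>"
    have cc: "?c \<in> carrier R" by simp
    have pc: "mmon R p \<in> carrier M" using 1(2) by (simp add: mmon_closed)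
    define r where "r = ?Dm \<ominus>\<^bsub>M\<^esub> ?c \<odot>\<^bsub>M\<^esub> mmon R p"
    have rc: "r \<in> carrier M" using Dmc pc by (simp add: r_def)
    have r_coeff: "r q = ?Dm q \<ominus> ?c \<otimes> mmon R p q" for q
      using pc Dmc by (simp add: r_def M.M.minus_eq mpoly_coeff mpoly_a_inv minus_eq)
    have "r \<in> ?I" using rc
    proof (induction rule: mpoly_linear_induct)
      case (monom q)
      have "q \<noteq> p" using monom(1) c by (auto simp: r_coeff mmon_def r_right_minus_eq)
      then have Dq: "?Dm q \<noteq> \<zero>" using monom(1) Dmc by (auto simp: r_coeff mmon_def minus_eq)
      then have "(q, p) \<in> mless" using low \<open>q \<noteq> p\<close> by blast
      moreover have qH: "set_mset q \<subseteq> bounded_vars H"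
      proof
        fix x assume x: "x \<in># q"
        have "set_mset (add_mset v m) \<subseteq> good" using v m by simp
        from D_support[OF this Dq x] show "x \<in> bounded_vars H"
          unfolding m_def by (rule bounded_lead[OF v(2) 1(3)])
      qed
      ultimately have "mmon R q \<in> ?I" using mless_bounded 1(1) monom(2) by blast
      then show ?case using I_smult mpoly_carrierD(1)[OF rc] by blast
    qed (use I_zero I_add in auto)
    moreover have "?Dm \<in> ?I" using mc by blast
    \<comment> \<open>The difference is written as a sum with a scalar multiple, since the image is
      known to be closed under these two operations.\<close>
    ultimately have "?Dm \<oplus>\<^bsub>M\<^esub> (\<ominus> \<one>) \<odot>\<^bsub>M\<^esub> r \<in> ?I" using I_add I_smult by simp
    also have "?Dm \<oplus>\<^bsub>M\<^esub> (\<ominus> \<one>) \<odot>\<^bsub>M\<^esub> r = ?c \<odot>\<^bsub>M\<^esub> mmon R p"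
    proof -
      have "?c \<odot>\<^bsub>M\<^esub> mmon R p \<in> carrier M" using pc by simp
      then show ?thesis using Dmc unfolding r_def
        by (simp add: M.smult_l_minus M.M.minus_eq M.M.minus_add M.M.a_assoc[symmetric] M.M.r_neg)
    qed
    finally have "inv ?c \<odot>\<^bsub>M\<^esub> (?c \<odot>\<^bsub>M\<^esub> mmon R p) \<in> ?I"
      using I_smult Units_of_nat[OF c(1)] by simp
    then show ?case
      using Units_of_nat[OF c(1)] pc by (simp add: M.smult_assoc1[symmetric])
  qed
  have "x \<in> ?I" using x
  proof (induction rule: mpoly_linear_induct)
    case (monom m)
    obtain H where "set_mset m \<subseteq> bounded_vars H" using bounded_vars_mset bounded_vars_ex by blast
    then show ?case using mon monom I_smult mpoly_carrierD(1)[OF x] by blast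
  qed (use I_zero I_add in auto)
  then show ?thesis by auto
qed

text \<open>Otherwise some terms of \<open>x\<close> contain moving letters. Their leading monomials
  are pairwise distinct by \<open>is_lead_unique\<close>, so a maximal one among them cannot cancel
  in \<open>D x\<close>; its coefficient is a unit times a nonzero coefficient of
  \<open>x\<close>.\<close>

lemma D_ker:
  assumes x: "x \<in> carrier M" and Dx: "D x = \<zero>\<^bsub>M\<^esub>" and m: "x m \<noteq> \<zero>" and v: "v \<in># m"
  shows "\<not> moving v"
proof
  assume "moving v"
  define S where "S = {m. x m \<noteq> \<zero> \<and> (\<exists>v\<in>#m. moving v)}"
  have S: "finite S" "S \<noteq> {}"
    using mpoly_carrierD(2)[OF x] m v \<open>moving v\<close> by (auto simp: S_def)
  define sel where "sel m = (SOME v. v \<in># m \<and> moving v \<and> precedes_all v m)" for m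
  have sel: "sel m \<in># m" "moving (sel m)" "precedes_all (sel m) m" if "m \<in> S" for m
  proof -
    have "\<exists>v. v \<in># m \<and> moving v \<and> precedes_all v m"
      using that ex_first_moving[of _ m] unfolding S_def by blast
    from someI_ex[OF this] show "sel m \<in># m" "moving (sel m)" "precedes_all (sel m) m"
      by (simp_all add: sel_def)
  qed
  define lead where "lead m = m - {#sel m#} + dmon (sel m)" for m
  have S_good: "set_mset m \<subseteq> good" if "m \<in> S" for m
    using that mpoly_carrierD(3)[OF x] by (auto simp: S_def)
  have is_lead: "is_lead (sel m) (lead m)" if "m \<in> S" for m
  proof -
    have "dmon (sel m) \<subseteq># lead m" "lead m - dmon (sel m) = m - {#sel m#}"
      unfolding lead_def by (rule mset_subset_eq_add_right, rule add_diff_cancel_right')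
    then show ?thesis using sel[OF that] by (auto simp: is_lead_def precedes_all_def dest: in_diffD)
  qed
  have lead_inj: "m = m'" if "m \<in> S" "m' \<in> S" "lead m = lead m'" for m m'
  proof -
    have "sel m = sel m'"
      using is_lead_unique[of "sel m" "sel m'" "lead m"] that is_lead sel(1) S_good by (metis subsetD)
    then show ?thesis using that(3) sel(1)[OF that(1)] sel(1)[OF that(2)]
      by (metis lead_def add_right_cancel insert_DiffM)
  qed
  have tri: "\<exists>c::nat. 0 < c \<and> D (mmon R m) (lead m) = add_pow R c \<one>"
    "D (mmon R m) q \<noteq> \<zero> \<Longrightarrow> q = lead m \<or> (q, lead m) \<in> mless" if "m \<in> S" for m q
  proof -
    have m: "add_mset (sel m) (m - {#sel m#}) = m" using sel[OF that] by simp
    have "sel m \<in> good" "precedes_all (sel m) (m - {#sel m#})" "set_mset (m - {#sel m#}) \<subseteq> good"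
      using sel[OF that] S_good[OF that] by (auto simp: precedes_all_def dest: in_diffD)
    from D_triangular[OF this(1) sel(2)[OF that] this(2,3)]
    show "\<exists>c::nat. 0 < c \<and> D (mmon R m) (lead m) = add_pow R c \<one>"
      "D (mmon R m) q \<noteq> \<zero> \<Longrightarrow> q = lead m \<or> (q, lead m) \<in> mless"
      unfolding m lead_def by blast+
  qed
  \<comment> \<open>With \<open>m0\<close> maximal in this sense, no other term of \<open>x\<close>
    contributes to the coefficient of \<open>lead m0\<close>.\<close>
  have "\<exists>m\<in>S. \<forall>m'\<in>S. m' \<noteq> m \<longrightarrow> (lead m, lead m') \<notin> mless"
    using S
    by (intro Finite_Set.bex_max_element)
      (auto simp: asymp_on_def transp_on_def dest: mless_asym mless_trans)
  then obtain m0 where m0: "m0 \<in> S" "\<forall>m'\<in>S. m' \<noteq> m0 \<longrightarrow> (lead m0, lead m') \<notin> mless"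
    by blast
  obtain c where c: "0 < (c::nat)" "D (mmon R m0) (lead m0) = add_pow R c \<one>" using tri(1) m0 by blast
  have xm0: "x m0 \<noteq> \<zero>" using m0 by (simp add: S_def)
  have "D x (lead m0) = (\<Oplus>m\<in>{m. x m \<noteq> \<zero>}. x m \<otimes> D (mmon R m) (lead m0))"
    by (rule mpoly_linear_coeff[OF D.d_linear x])
  also have "\<dots> = (\<Oplus>m\<in>{m. x m \<noteq> \<zero>}. if m0 = m then x m \<otimes> add_pow R c \<one> else \<zero>)"
  proof (rule finsum_cong')
    fix m assume "m \<in> {m. x m \<noteq> \<zero>}"
    then have m: "set_mset m \<subseteq> good" "x m \<noteq> \<zero>" using mpoly_carrierD(3)[OF x] by auto
    show "x m \<otimes> D (mmon R m) (lead m0) = (if m0 = m then x m \<otimes> add_pow R c \<one> else \<zero>)"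
    proof (cases "m0 = m")
      case False
      have "D (mmon R m) (lead m0) = \<zero>"
      proof (cases "m \<in> S")
        case True
        then show ?thesis using tri(2) m0 lead_inj False by metis
      next
        case False
        then show ?thesis using m by (intro D_const) (auto simp: S_def)
      qed
      then show ?thesis using False mpoly_carrierD(1)[OF x] by simp
    qed (use c in simp)
  qed (use mpoly_carrierD(1)[OF x] in auto)
  also have "\<dots> = x m0 \<otimes> add_pow R c \<one>"
    using mpoly_carrierD(1,2)[OF x] xm0 by (intro add.finprod_singleton) auto
  finally have "x m0 \<otimes> add_pow R c \<one> = \<zero>" using Dx by (simp add: mpoly_coeff)
  then have "x m0 \<otimes> (add_pow R c \<one> \<otimes> inv (add_pow R c \<one>)) = \<zero>"
    using Units_of_nat[OF c(1)] mpoly_carrierD(1)[OF x] by (simp add: m_assoc[symmetric] del: Units_r_inv)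
  then show False using Units_of_nat[OF c(1)] mpoly_carrierD(1)[OF x] xm0 by simp
qed

text \<open>These values are forced: initial values are fixed under initialisation, and integrals
  vanish under it.\<close>

primrec init_var :: "idvar \<Rightarrow> idvar multiset \<Rightarrow> 'a" where
  "init_var (Init i) = mmon R {#Init i#}"
| "init_var (Der i) = mmon R {#Init i#}"
| "init_var (Integ s) = \<zero>\<^bsub>M\<^esub>"

definition E :: "(idvar multiset \<Rightarrow> 'a) \<Rightarrow> idvar multiset \<Rightarrow> 'a" where
  "E = M.meval init_var"

lemma init_var_closed [simp]: "init_var x \<in> carrier M"
  by (cases x) (auto intro!: mmon_closed good.Init)

lemma E_hom: "E \<in> algebra_hom R M M"
  unfolding E_def by (rule meval_hom[OF M.algebra_axioms init_var_closed])

lemma E_var: "E (mmon R {#x#}) = init_var x"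
  unfolding E_def using M.meval_var[of init_var x] by simp

lemmas E_closed = algebra_homD(1)[OF E_hom]
lemmas E_mult = algebra_homD(3)[OF E_hom]

lemma E_init_var: "E (init_var x) = init_var x"
  using M.linear_map_zero[OF algebra_hom_linear[OF E_hom] M.algebra_axioms] by (cases x) (simp_all add: E_var)

lemma E_idem: "x \<in> carrier M \<Longrightarrow> E (E x) = E x"
  by (rule mpoly_hom_eqI[OF M.algebra_axioms algebra_hom_comp[OF E_hom E_hom] E_hom])
    (simp_all add: E_var E_init_var)

lemma D_init_var: "D (init_var x) = \<zero>\<^bsub>M\<^esub>"
  by (cases x) (simp_all add: D_var good.Init \<delta>_def D.d_zero)

lemma D_E:
  assumes "x \<in> carrier M"
  shows "D (E x) = \<zero>\<^bsub>M\<^esub>"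
proof (rule M.mpoly_linear_eqI[where f = "\<lambda>x. D (E x)" and g = "\<lambda>_. \<zero>\<^bsub>M\<^esub>"])
  show "linear_map R M M (\<lambda>x. D (E x))"
    by (rule linear_map_comp[OF algebra_hom_linear[OF E_hom] D.d_linear])
  show "linear_map R M M (\<lambda>_. \<zero>\<^bsub>M\<^esub>)" by (auto simp: linear_map_def)
  show "D (E (mmon R m)) = \<zero>\<^bsub>M\<^esub>" if "set_mset m \<subseteq> good" for m
    using that
  proof (induction m)
    case empty
    then show ?case using algebra_homD(5)[OF E_hom] by (simp add: mpoly_one D_one_mmon)
  next
    case (add x m)
    have "E (mmon R (add_mset x m)) = E (mmon R {#x#} \<otimes>\<^bsub>M\<^esub> mmon R m)" by (simp add: mmon_mult)
    also have "\<dots> = init_var x \<otimes>\<^bsub>M\<^esub> E (mmon R m)"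
      using add.prems by (simp add: E_mult mmon_closed E_var)
    finally show ?case
      using add w_closed by (simp add: D.d_mult D_init_var E_closed mmon_closed)
  qed
qed (rule assms)

text \<open>By \<open>D_ker\<close> such an \<open>x\<close> is a polynomial in the constants
  \<open>Init i\<close> alone. On that smaller polynomial algebra \<open>E\<close> and the identity
  are homomorphisms agreeing on variables.\<close>

lemma D_ker_E:
  assumes x: "x \<in> carrier M" and Dx: "D x = \<zero>\<^bsub>M\<^esub>"
  shows "E x = x"
proof -
  let ?V = "{v. \<not> moving v}"
  have x': "x \<in> carrier (mpoly R ?V)"
    using mpoly_carrierD[OF x] D_ker[OF x Dx]
    by (intro mpoly_carrierI[of x "{m. x m \<noteq> \<zero>}"]) auto
  have V: "?V \<subseteq> good"
  proof
    fix v assume "v \<in> ?V"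
    then show "v \<in> good" by (cases v) (auto intro: good.Init)
  qed
  have "E \<in> algebra_hom R (mpoly R ?V) M"
    unfolding E_def by (rule meval_hom[OF M.algebra_axioms init_var_closed])
  moreover have "(\<lambda>x. x) \<in> algebra_hom R (mpoly R ?V) M"
    using mpoly_mono[OF V] by (auto simp: algebra_hom_def ring_hom_def mpoly_def)
  moreover have "E (mmon R {#v#}) = mmon R {#v#}" if "v \<in> ?V" for v
    using that by (cases v) (simp_all add: E_var)
  ultimately show ?thesis
    using x' by (rule mpoly_hom_eqI[OF M.algebra_axioms])
qed

lemma ex_integral:
  obtains P where "comm_integro_diff_algebra R M w D P"
    and "\<And>x. x \<in> carrier M \<Longrightarrow> comm_integro_diff_algebra.initial M D P x = E x"
  using D.integro_diff_algebra_of_initialisation[of E] algebra_hom_linear[OF E_hom]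
    E_mult E_idem D_E D_ker_E D_surj by blast

end

section \<open>Freeness\<close>

lemma diff_hom_mpolyI:
  assumes d: "comm_diff_algebra k (mpoly k V) w d" and A: "comm_diff_algebra k A w dA"
    and h: "h \<in> algebra_hom k (mpoly k V) A"
    and var: "\<And>x. x \<in> V \<Longrightarrow> h (d (mmon k {#x#})) = dA (h (mmon k {#x#}))"
  shows "h \<in> diff_hom k (mpoly k V) d A dA"
proof -
  let ?A = "mpoly k V"
  interpret d: comm_diff_algebra k ?A w d by fact
  interpret A: comm_diff_algebra k A w dA by fact
  note hD = algebra_homD[OF h]
  have mon: "h (d (mmon k m)) = dA (h (mmon k m))" if "set_mset m \<subseteq> V" for m
    using that
  proof (induction m)
    case empty
    have "h (d \<one>\<^bsub>?A\<^esub>) = dA (h \<one>\<^bsub>?A\<^esub>)"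
      using A.linear_map_zero[OF algebra_hom_linear[OF h] d.algebra_axioms]
      by (simp add: d.d_one hD(5) A.d_one)
    then show ?case by (simp add: d.R.mpoly_one)
  next
    case (add x m)
    let ?x = "mmon k {#x#}" and ?m = "mmon k m"
    have c: "?x \<in> carrier ?A" "?m \<in> carrier ?A" using add.prems by (auto simp: d.R.mmon_closed)
    have "mmon k (add_mset x m) = ?x \<otimes>\<^bsub>?A\<^esub> ?m" by (simp add: d.R.mmon_mult)
    moreover have "h (d (?x \<otimes>\<^bsub>?A\<^esub> ?m)) = dA (h (?x \<otimes>\<^bsub>?A\<^esub> ?m))"
      using c add var by (simp add: d.d_mult A.d_mult d.d_closed d.weight_closed hD)
    ultimately show ?case by simp
  qed
  have "h (d x) = dA (h x)" if "x \<in> carrier ?A" for x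
    using linear_map_comp[OF d.d_linear algebra_hom_linear[OF h]]
      linear_map_comp[OF algebra_hom_linear[OF h] A.d_linear] mon that
    by (rule A.mpoly_linear_eqI)
  then show ?thesis using h by (simp add: diff_hom_def)
qed

lemma integro_diff_hom_comp:
  "f \<in> integro_diff_hom k A dA pA B dB pB \<Longrightarrow> g \<in> integro_diff_hom k B dB pB C dC pC \<Longrightarrow>
    (\<lambda>x. g (f x)) \<in> integro_diff_hom k A dA pA C dC pC"
  by (auto simp: integro_diff_hom_def diff_hom_def algebra_homD(1) intro: algebra_hom_comp)

lemma integro_diff_hom_initial:
  assumes "comm_integro_diff_algebra k A w dA pA" "comm_integro_diff_algebra k B w dB pB"
    and f: "f \<in> integro_diff_hom k A dA pA B dB pB" and x: "x \<in> carrier A"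
  shows "f (comm_integro_diff_algebra.initial A dA pA x) = comm_integro_diff_algebra.initial B dB pB (f x)"
proof -
  interpret A: comm_integro_diff_algebra k A w dA pA by fact
  interpret B: comm_integro_diff_algebra k B w dB pB by fact
  have fl: "linear_map k A B f" using f by (auto simp: integro_diff_hom_def diff_hom_def intro: algebra_hom_linear)
  have "f (pA (dA x)) = pB (dB (f x))"
    using f x by (simp add: integro_diff_hom_def diff_hom_def A.d_closed)
  then show ?thesis unfolding A.initial_def B.initial_def
    using x B.linear_map_minus[OF fl A.algebra_axioms] by (simp add: A.P_closed A.d_closed)
qed

context comm_integro_diff_algebra
begin

text \<open>The values are given on all of \<open>idvar\<close> rather than on \<open>good\<close>
  only, which permits plain recursion; \<open>u j\<close> is the prescribed image of the
  \<open>j\<close>-th derivative.\<close>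

primrec extend :: "(nat \<Rightarrow> 'c) \<Rightarrow> idvar \<Rightarrow> 'c" where
  "extend u (Init i) = initial (u i)"
| "extend u (Der i) = u i"
| "extend u (Integ s) = P (mprod (image_mset (extend u) s))"

lemma extend_closed:
  assumes "\<And>j. u j \<in> carrier M"
  shows "extend u x \<in> carrier M"
  using assms linear_mapD(1)[OF initial_linear]
  by (induction x) (auto intro!: P_closed mprod_closed)

end

context idmodel
begin

text \<open>Compatibility with the integrals is obtained through \<open>integro_diff_homI\<close>:
  commuting with initialisation is an equality of two algebra homomorphisms, so it needs checking
  only on variables.\<close>

lemma ex_integro_diff_hom:
  assumes M: "comm_integro_diff_algebra R M w D P"
    and M_initial: "\<And>x. x \<in> carrier M \<Longrightarrow> comm_integro_diff_algebra.initial M D P x = E x"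
    and F: "comm_integro_diff_algebra R F w DF PF"
    and u: "\<And>j. u j \<in> carrier F" "\<And>j. DF (u j) = u (Suc j)"
  obtains h where "h \<in> integro_diff_hom R M D P F DF PF" "\<And>j. h (mmon R {#Der j#}) = u j"
proof -
  interpret F: comm_integro_diff_algebra R F w DF PF by fact
  define h :: "(idvar multiset \<Rightarrow> 'a) \<Rightarrow> 'c" where "h = F.meval (F.extend u)"
  note ec = F.extend_closed[of u, OF u(1)]
  have h_hom: "h \<in> algebra_hom R M F" unfolding h_def by (rule meval_hom[OF F.algebra_axioms ec])
  have h_mon: "h (mmon R m) = F.mprod (image_mset (F.extend u) m)" for m
    unfolding h_def by (rule F.meval_mmon[OF ec])
  have h_var: "h (mmon R {#x#}) = F.extend u x" for x
    unfolding h_mon using ec[of x] by simp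
  have h_zero: "h \<zero>\<^bsub>M\<^esub> = \<zero>\<^bsub>F\<^esub>"
    by (rule F.linear_map_zero[OF algebra_hom_linear[OF h_hom] M.algebra_axioms])
  have "h \<in> diff_hom R M D F DF"
  proof (rule diff_hom_mpolyI[OF D.comm_diff_algebra_axioms F.comm_diff_algebra_axioms h_hom])
    fix x assume "x \<in> good"
    then show "h (D (mmon R {#x#})) = DF (h (mmon R {#x#}))"
    proof (cases x)
      case (Integ s)
      have "set_mset (image_mset (F.extend u) s) \<subseteq> carrier F" using ec by auto
      then show ?thesis using Integ \<open>x \<in> good\<close> by (simp add: D_var \<delta>_def h_mon[of s] h_var F.D_P)
    qed (use \<open>x \<in> good\<close> in \<open>simp_all add: D_var \<delta>_def h_var h_zero u F.d_initial\<close>)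
  qed
  moreover have "h (comm_integro_diff_algebra.initial M D P x) = F.initial (h x)" if x: "x \<in> carrier M" for x
  proof -
    have init: "F.initial \<in> algebra_hom R F F"
      using F.initial_linear F.initial_mult F.initial_one by (rule algebra_homI)
    have "h (E (mmon R {#v#})) = F.initial (h (mmon R {#v#}))" if "v \<in> good" for v
    proof (cases v)
      case (Integ s)
      have "set_mset (image_mset (F.extend u) s) \<subseteq> carrier F" using ec by auto
      then show ?thesis using Integ by (simp add: E_var h_var h_zero F.initial_P)
    qed (simp_all add: E_var h_var u F.initial_idem)
    then have "h (E x) = F.initial (h x)"
      using x by (rule mpoly_hom_eqI[OF F.algebra_axioms algebra_hom_comp[OF E_hom h_hom]
            algebra_hom_comp[OF h_hom init]])
    then show ?thesis using M_initial[OF x] by simp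
  qed
  ultimately have "h \<in> integro_diff_hom R M D P F DF PF" by (rule integro_diff_homI[OF M F])
  then show ?thesis using that h_var by simp
qed

text \<open>All variables are generated from the \<open>Der j\<close>: \<open>Init i\<close> is the
  initial value of \<open>Der i\<close>, and \<open>Integ s\<close> is the integral of the monomial
  \<open>s\<close>, whose letters are earlier in the recursion.\<close>

lemma integro_diff_hom_unique:
  assumes M: "comm_integro_diff_algebra R M w D P"
    and M_initial: "\<And>x. x \<in> carrier M \<Longrightarrow> comm_integro_diff_algebra.initial M D P x = E x"
    and F: "comm_integro_diff_algebra R F w DF PF"
    and g: "g \<in> integro_diff_hom R M D P F DF PF" and h: "h \<in> integro_diff_hom R M D P F DF PF"
    and eq: "\<And>j. g (mmon R {#Der j#}) = h (mmon R {#Der j#})"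
    and x: "x \<in> carrier M"
  shows "g x = h x"
proof -
  interpret M: comm_integro_diff_algebra R M w D P by fact
  interpret F: comm_integro_diff_algebra R F w DF PF by fact
  have g_hom: "g \<in> algebra_hom R M F" and h_hom: "h \<in> algebra_hom R M F"
    using g h by (auto simp: integro_diff_hom_def diff_hom_def)
  have "v \<in> good \<Longrightarrow> g (mmon R {#v#}) = h (mmon R {#v#})" for v
  proof (induction v)
    case (Init i)
    have c: "mmon R {#Der i#} \<in> carrier M" by (intro mmon_closed) (simp add: good.Der)
    have "mmon R {#Init i#} = M.initial (mmon R {#Der i#})"
      using M_initial[OF c] by (simp add: E_var)
    then show ?case
      using integro_diff_hom_initial[OF M F g c] integro_diff_hom_initial[OF M F h c] eq by simp
  next
    case (Der j)
    show ?case by (rule eq)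
  next
    case (Integ s)
    have s: "set_mset s \<subseteq> good" using Integ.prems good_IntegD(1) by blast
    then have c: "mmon R {#Integ s#} \<in> carrier M" "mmon R s \<in> carrier M"
      using Integ.prems by (simp_all add: mmon_closed)
    have "P (D (mmon R {#Integ s#})) = mmon R {#Integ s#}"
      using c M_initial[OF c(1)] by (intro M.P_unique) (simp_all add: E_var)
    then have P: "mmon R {#Integ s#} = P (mmon R s)"
      using Integ.prems by (simp add: D_var \<delta>_def)
    \<comment> \<open>The induction runs over submultisets of \<open>s\<close>, because the outer
      hypothesis is available for letters of \<open>s\<close> only.\<close>
    have "g (mmon R s') = h (mmon R s')" if "s' \<subseteq># s" for s'
      using that
    proof (induction s')
      case empty
      show ?case using algebra_homD(5)[OF g_hom] algebra_homD(5)[OF h_hom] by (simp add: mpoly_one)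
    next
      case (add y t)
      have yt: "y \<in># s" "t \<subseteq># s" using add.prems
        by (auto dest: mset_subset_eq_insertD subset_mset.less_imp_le)
      have c: "mmon R {#y#} \<in> carrier M" "mmon R t \<in> carrier M"
        using yt s by (auto intro!: mmon_closed dest: mset_subset_eqD)
      have "g (mmon R {#y#}) = h (mmon R {#y#})" using Integ.IH[OF yt(1)] yt(1) s by blast
      then have "g (mmon R {#y#} \<otimes>\<^bsub>M\<^esub> mmon R t) = h (mmon R {#y#} \<otimes>\<^bsub>M\<^esub> mmon R t)"
        using add.IH[OF yt(2)] c by (simp add: algebra_homD(3)[OF g_hom] algebra_homD(3)[OF h_hom])
      then show ?case by (simp add: mmon_mult)
    qed
    then have "g (mmon R s) = h (mmon R s)" by simp
    then show ?case unfolding P using g h c by (simp add: integro_diff_hom_def)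
  qed
  then show ?thesis by (rule mpoly_hom_eqI[OF F.algebra_axioms g_hom h_hom _ x])
qed

end

section \<open>Renaming of variables\<close>

lemma algebra_hom_id: "(\<lambda>x. x) \<in> algebra_hom k A A"
  by (auto simp: algebra_hom_def ring_hom_def)

lemma (in cring) mpoly_rename:
  assumes \<rho>: "inj_on \<rho> G"
  obtains r where "r \<in> algebra_hom R (mpoly R G) (mpoly R (\<rho> ` G))"
    and "bij_betw r (carrier (mpoly R G)) (carrier (mpoly R (\<rho> ` G)))"
proof -
  let ?A = "mpoly R G" and ?B = "mpoly R (\<rho> ` G)"
  let ?\<sigma> = "inv_into G \<rho>"
  interpret A: algebra R ?A by (rule algebra_mpoly)
  interpret B: algebra R ?B by (rule algebra_mpoly)
  define r where "r = B.meval (\<lambda>x. mmon R {#\<rho> x#})"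
  define s where "s = A.meval (\<lambda>y. mmon R {#?\<sigma> y#})"
  have r: "r \<in> algebra_hom R ?A ?B" unfolding r_def
    by (rule meval_hom[OF B.algebra_axioms]) (simp add: mmon_closed)
  have s: "s \<in> algebra_hom R ?B ?A" unfolding s_def
    by (rule meval_hom[OF A.algebra_axioms]) (auto simp: inv_into_into intro!: mmon_closed)
  have r_var: "r (mmon R {#x#}) = mmon R {#\<rho> x#}" if "x \<in> G" for x
    unfolding r_def using that by (intro B.meval_var) (simp add: mmon_closed)
  have s_var: "s (mmon R {#\<rho> x#}) = mmon R {#x#}" if "x \<in> G" for x
    using that A.meval_var[of "\<lambda>y. mmon R {#?\<sigma> y#}" "\<rho> x"] \<rho> unfolding s_def
    by (simp add: mmon_closed)
  have "s (r p) = p" if "p \<in> carrier ?A" for p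
    using that
    by (rule mpoly_hom_eqI[OF A.algebra_axioms algebra_hom_comp[OF r s] algebra_hom_id, rotated]) (simp add: r_var s_var)
  moreover have "r (s q) = q" if "q \<in> carrier ?B" for q
    using that
    by (rule mpoly_hom_eqI[OF B.algebra_axioms algebra_hom_comp[OF s r] algebra_hom_id, rotated]) (auto simp: r_var s_var)
  ultimately have "bij_betw r (carrier ?A) (carrier ?B)"
    using algebra_homD(1)[OF r] algebra_homD(1)[OF s] by (intro bij_betwI[where g = s] Pi_I)
  with r show ?thesis by (rule that)
qed

section \<open>Rational scalars and the isomorphism with the free algebra\<close>

lemma rat_algebra_Units:
  assumes "algebra (ring_of_type_algebra :: rat ring) k" "0 < (n :: nat)"
  shows "add_pow k n \<one>\<^bsub>k\<^esub> \<in> Units k"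
proof -
  interpret algebra "ring_of_type_algebra :: rat ring" k by fact
  have [simp]: "carrier (ring_of_type_algebra :: rat ring) = UNIV"
    "\<one>\<^bsub>(ring_of_type_algebra :: rat ring)\<^esub> = 1"
    "x \<otimes>\<^bsub>(ring_of_type_algebra :: rat ring)\<^esub> y = x * y"
    "x \<oplus>\<^bsub>(ring_of_type_algebra :: rat ring)\<^esub> y = x + y" 
    "\<zero>\<^bsub>(ring_of_type_algebra :: rat ring)\<^esub> = 0" for x y
    by (simp_all add: ring_of_type_algebra_def)
  have c: "q \<odot>\<^bsub>k\<^esub> \<one>\<^bsub>k\<^esub> \<in> carrier k" for q by simp
  have n: "add_pow k n \<one>\<^bsub>k\<^esub> = of_nat n \<odot>\<^bsub>k\<^esub> \<one>\<^bsub>k\<^esub>" for n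
  proof (induction n)
    case 0
    then show ?case using smult_l_null[of "\<one>\<^bsub>k\<^esub>"] by simp
  next
    case (Suc n)
    then show ?case
      using smult_l_distr[of "of_nat n" 1 "\<one>\<^bsub>k\<^esub>"] smult_one[of "\<one>\<^bsub>k\<^esub>"] by (simp add: add.commute)
  qed
  let ?u = "of_nat n \<odot>\<^bsub>k\<^esub> \<one>\<^bsub>k\<^esub>" and ?v = "inverse (of_nat n) \<odot>\<^bsub>k\<^esub> \<one>\<^bsub>k\<^esub>"
  have vu: "?v \<otimes>\<^bsub>k\<^esub> ?u = \<one>\<^bsub>k\<^esub>"
    using smult_assoc2[of "inverse (of_nat n)" "\<one>\<^bsub>k\<^esub>" ?u]
      smult_assoc1[of "inverse (of_nat n)" "of_nat n" "\<one>\<^bsub>k\<^esub>"] smult_one[of "\<one>\<^bsub>k\<^esub>"] assms(2) c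
    by simp
  moreover have "?u \<otimes>\<^bsub>k\<^esub> ?v = \<one>\<^bsub>k\<^esub>" using vu m_comm[OF c c] by metis
  ultimately have "?u \<in> Units k" unfolding Units_def using c by blast
  then show ?thesis by (simp only: n)
qed

text \<open>Freeness for a copy of the model gives \<open>g\<close> from \<open>F\<close> to the
  model, and the explicit construction gives \<open>h\<close> in the other direction. The composite
  on \<open>F\<close> is the identity by freeness tested on \<open>F\<close> itself, the one on the
  model by \<open>integro_diff_hom_unique\<close>.\<close>

theorem proposition4p11:
  fixes k :: "(rat, 'k) module"
    and w :: 'k
    and d :: "(nat multiset \<Rightarrow> 'k) \<Rightarrow> (nat multiset \<Rightarrow> 'k)"
    and F :: "('k, 'f) module"
    and D P :: "'f \<Rightarrow> 'f"
    and i :: "(nat multiset \<Rightarrow> 'k) \<Rightarrow> 'f"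
  assumes k_alg: "algebra (ring_of_type_algebra :: rat ring) k"
    and w_closed: "w \<in> carrier k"
    and d_diff: "comm_diff_algebra k (mpoly k (UNIV :: nat set)) w d"
    and d_var: "\<And>j. d (ring.indexed_var k j) = ring.indexed_var k (Suc j)"
    and free_F: "free_comm_integro_diff TYPE('f) k w (mpoly k (UNIV :: nat set)) d F D P i"
    and free_universe: "free_comm_integro_diff TYPE(nat \<Rightarrow> 'k) k w (mpoly k (UNIV :: nat set)) d F D P i"
  shows "\<exists>(V :: 'f set) h. h \<in> algebra_hom k F (mpoly k V) \<and>
           bij_betw h (carrier F) (carrier (mpoly k V))"
proof -
  let ?A = "mpoly k (UNIV :: nat set)" and ?M = "mpoly k good"
  interpret k: cring k using k_alg by (rule algebra.M_cring)
  interpret m: idmodel k w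
    by unfold_locales (use w_closed rat_algebra_Units[OF k_alg] in auto)
  have F: "comm_integro_diff_algebra k F w D P" and i: "i \<in> diff_hom k ?A d F D"
    using free_F by (auto simp: free_comm_integro_diff_def)
  interpret F: comm_integro_diff_algebra k F w D P by fact
  obtain PM where M: "comm_integro_diff_algebra k ?M w m.D PM"
    and M_initial: "\<And>x. x \<in> carrier ?M \<Longrightarrow> comm_integro_diff_algebra.initial ?M m.D PM x = m.E x"
    using m.ex_integral by blast
  have i_hom: "i \<in> algebra_hom k ?A F" and i_d: "\<And>x. x \<in> carrier ?A \<Longrightarrow> i (d x) = D (i x)"
    using i by (auto simp: diff_hom_def)
  have varA: "mmon k {#j#} \<in> carrier ?A" for j by (simp add: k.mmon_closed)
  have varM: "mmon k {#Der j#} \<in> carrier ?M" for j by (simp add: k.mmon_closed good.Der)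
  note d_var' = d_var[unfolded k.indexed_var_mmon]
  define u where "u j = i (mmon k {#j#})" for j
  have u: "u j \<in> carrier F" "D (u j) = u (Suc j)" for j
    using algebra_homD(1)[OF i_hom varA] i_d[OF varA, of j] by (simp_all add: u_def d_var')
  obtain h where h: "h \<in> integro_diff_hom k ?M m.D PM F D P" and h_Der: "\<And>j. h (mmon k {#Der j#}) = u j"
    using m.ex_integro_diff_hom[where u = u, OF M M_initial F u] by blast
  have h_hom: "h \<in> algebra_hom k ?M F" using h by (auto simp: integro_diff_hom_def diff_hom_def)
  define iM where "iM = m.M.meval (\<lambda>j :: nat. mmon k {#Der j#})"
  have iM_hom: "iM \<in> algebra_hom k ?A ?M"
    unfolding iM_def by (rule meval_hom[OF m.M.algebra_axioms varM])
  have iM_var: "iM (mmon k {#j#}) = mmon k {#Der j#}" for j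
    using m.M.meval_var[of "\<lambda>j. mmon k {#Der j#}", OF varM] by (simp add: iM_def)
  have iM: "iM \<in> diff_hom k ?A d ?M m.D"
    by (rule diff_hom_mpolyI[OF d_diff m.D.comm_diff_algebra_axioms iM_hom])
      (simp add: iM_var d_var' m.D_var m.\<delta>_def good.Der)

  \<comment> \<open>The coefficients are listed along an enumeration of all words in the variables.
    Every monomial is the multiset of some word, so none is lost.\<close>
  define \<phi> :: "(idvar multiset \<Rightarrow> 'k) \<Rightarrow> nat \<Rightarrow> 'k" where "\<phi> p = (\<lambda>n. p (mset (from_nat n)))" for p
  have "inj \<phi>"
  proof (rule injI)
    fix p q assume "\<phi> p = \<phi> q"
    then have "\<phi> p (to_nat xs) = \<phi> q (to_nat xs)" for xs :: "idvar list" by simp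
    then have "p (mset xs) = q (mset xs)" for xs by (simp add: \<phi>_def)
    then show "p = q" by (metis ext ex_mset)
  qed
  note tr = transport_integro_diff[OF \<open>inj \<phi>\<close> M]
  obtain g' where g': "g' \<in> integro_diff_hom k F D P (transport_module \<phi> ?M)
      (\<lambda>x. \<phi> (m.D (inv_into UNIV \<phi> x))) (\<lambda>x. \<phi> (PM (inv_into UNIV \<phi> x)))"
    and g'_i: "\<And>a. a \<in> carrier ?A \<Longrightarrow> g' (i a) = \<phi> (iM a)"
    using free_universe[unfolded free_comm_integro_diff_def, THEN conjunct2, THEN conjunct2,
      rule_format, OF tr(1) tr(2)[OF iM]] by blast
  define g where "g x = inv_into UNIV \<phi> (g' x)" for x
  have g: "g \<in> integro_diff_hom k F D P ?M m.D PM" using tr(3)[OF g'] by (simp add: g_def[abs_def])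
  have g_hom: "g \<in> algebra_hom k F ?M" using g by (auto simp: integro_diff_hom_def diff_hom_def)
  have g_i: "g (i a) = iM a" if "a \<in> carrier ?A" for a
    using g'_i[OF that] \<open>inj \<phi>\<close> by (simp add: g_def)

  have "h (iM a) = i a" if "a \<in> carrier ?A" for a
    using that
    by (rule mpoly_hom_eqI[OF F.algebra_axioms algebra_hom_comp[OF iM_hom h_hom] i_hom, rotated])
      (simp add: iM_var h_Der u_def)
  then have hg_i: "h (g (i a)) = i a" if "a \<in> carrier ?A" for a
    using that g_i by simp
  have id_F: "(\<lambda>x. x) \<in> integro_diff_hom k F D P F D P"
    by (auto simp: integro_diff_hom_def diff_hom_def algebra_hom_def ring_hom_def)
  have hg: "h (g x) = x" if "x \<in> carrier F" for x
  proof -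
    obtain f where f: "\<forall>h \<in> integro_diff_hom k F D P F D P.
        (\<forall>a\<in>carrier ?A. h (i a) = i a) \<longrightarrow> (\<forall>x\<in>carrier F. h x = f x)"
      using free_F[unfolded free_comm_integro_diff_def, THEN conjunct2, THEN conjunct2,
        rule_format, OF F i] by blast
    have "h (g x) = f x" using bspec[OF f integro_diff_hom_comp[OF g h]] hg_i that by blast
    also have "\<dots> = x" using bspec[OF f id_F] that by simp
    finally show ?thesis .
  qed
  have id_M: "(\<lambda>x. x) \<in> integro_diff_hom k ?M m.D PM ?M m.D PM"
    by (auto simp: integro_diff_hom_def diff_hom_def algebra_hom_def ring_hom_def)
  have gh: "g (h x) = x" if "x \<in> carrier ?M" for x
  proof (rule m.integro_diff_hom_unique[OF M M_initial M integro_diff_hom_comp[OF h g] id_M _ that])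
    show "g (h (mmon k {#Der j#})) = mmon k {#Der j#}" for j
      using g_i[OF varA] by (simp add: h_Der u_def iM_var)
  qed
  have g_bij: "bij_betw g (carrier F) (carrier ?M)"
    using algebra_homD(1)[OF g_hom] algebra_homD(1)[OF h_hom] hg gh
    by (intro bij_betwI[where g = h] Pi_I)

  have "\<exists>(V :: 'f set) r. r \<in> algebra_hom k ?M (mpoly k V) \<and> bij_betw r (carrier ?M) (carrier (mpoly k V))"
  proof (cases "\<one>\<^bsub>k\<^esub> = \<zero>\<^bsub>k\<^esub>")
    \<comment> \<open>Over the zero ring all monomials coincide, so variables cannot be told apart
      inside \<open>F\<close>; but then every polynomial algebra is zero and the empty set of
      variables will do.\<close>
    case True
    have zero: "carrier (mpoly k W) = {\<zero>\<^bsub>mpoly k W\<^esub>}" for W :: "'z set"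
    proof -
      interpret W: algebra k "mpoly k W" by (rule k.algebra_mpoly)
      have "p = \<zero>\<^bsub>mpoly k W\<^esub>" if "p \<in> carrier (mpoly k W)" for p
      proof
        show "p m = \<zero>\<^bsub>mpoly k W\<^esub> m" for m
          using k.mpoly_carrierD(1)[OF that, of m] k.one_zeroD[OF True] by (simp add: k.mpoly_coeff)
      qed
      then show ?thesis by auto
    qed
    let ?B = "mpoly k ({} :: 'f set)"
    interpret B: algebra k ?B by (rule k.algebra_mpoly)
    have r: "B.meval (\<lambda>_. \<zero>\<^bsub>?B\<^esub>) \<in> algebra_hom k ?M ?B"
      by (rule meval_hom[OF B.algebra_axioms]) simp
    then have "bij_betw (B.meval (\<lambda>_. \<zero>\<^bsub>?B\<^esub>)) (carrier ?M) (carrier ?B)"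
      using algebra_homD(1)[OF r] unfolding zero bij_betw_def by auto
    with r show ?thesis by blast
  next
    case False
    \<comment> \<open>The variables are named by their own images in \<open>F\<close>, which yields
      a set of variables of type \<open>'f\<close>.\<close>
    let ?\<rho> = "\<lambda>x. h (mmon k {#x#})"
    have inj: "inj_on ?\<rho> good"
    proof (rule inj_onI)
      fix x y assume xy: "x \<in> good" "y \<in> good" "h (mmon k {#x#}) = h (mmon k {#y#})"
      have c: "mmon k {#x#} \<in> carrier ?M" "mmon k {#y#} \<in> carrier ?M"
        using xy(1,2) by (simp_all add: k.mmon_closed)
      have "mmon k {#x#} = mmon k {#y#}" using gh[OF c(1)] gh[OF c(2)] xy(3) by metis
      then have "mmon k {#x#} {#x#} = mmon k {#y#} {#x#}" by (rule fun_cong)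
      then show "x = y" using False by (auto simp: mmon_def split: if_splits)
    qed
    obtain r where "r \<in> algebra_hom k ?M (mpoly k (?\<rho> ` good))"
      "bij_betw r (carrier ?M) (carrier (mpoly k (?\<rho> ` good)))"
      using inj by (rule k.mpoly_rename)
    then show ?thesis by blast
  qed
  then obtain V :: "'f set" and r where r: "r \<in> algebra_hom k ?M (mpoly k V)"
    and r_bij: "bij_betw r (carrier ?M) (carrier (mpoly k V))" by blast
  have "(\<lambda>x. r (g x)) \<in> algebra_hom k F (mpoly k V)" using g_hom r by (rule algebra_hom_comp)
  moreover have "bij_betw (\<lambda>x. r (g x)) (carrier F) (carrier (mpoly k V))"
    using bij_betw_trans[OF g_bij r_bij] by (simp add: comp_def)
  ultimately show ?thesis by blast
qed

end
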